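(* Let $D=(N,\le_1,\le_2)$ be a locally special double poset on a finite set $N$, and let $\mathfrak{G}\subseteq \operatorname{Aut}(D)$ be a subgroup. Then the $D$-partition quasisymmetric class function $\Omega(D,\mathfrak{G},\mathbf{x})$ is $F$-effective.
   Context: A double poset on a finite set $N$ is a triple $D=(N,\le_1,\le_2)$ of two partial orders on $N$. It is locally special if whenever $y$ covers $x$ in $\le_1$, the elements $x,y$ are $\le_2$-comparable. An automorphism of $D$ is a bijection $\sigma:N\to N$ with $x\le_i y \iff \sigma(x)\le_i\sigma(y)$ for $i=1,2$; $\operatorname{Aut}(D)$ is the group of these. A $D$-partition is a map $f:N\to\{1,2,3,\dots\}$ such that $i\le_1 j$ implies $f(i)\le f(j)$, and $i<_1 j$ together with $j<_2 i$ implies $f(i)<f(j)$. For $\mathfrak{g}\in\mathfrak{G}$ set $\Omega(D,\mathfrak{G},\mathbf{x};\mathfrak{g})=\sum_{f}\prod_{v\in N}x_{f(v)}$, the sum over $D$-partitions $f$ with $f\circ\mathfrak{g}=f$; this defines a class function on $\mathfrak{G}$ with values in the ring $\mathrm{QSym}$ of quasisymmetric functions (over $\mathbb{C}$) in $x_1,x_2,\dots$. Integer compositions of $n$ are ordered by refinement: $\alpha\le\beta$ iff $\beta$ refines $\alpha$. The monomial quasisymmetric functions are $M_\alpha=\sum_{i_1<\dots<i_k}x_{i_1}^{\alpha_1}\cdots x_{i_k}^{\alpha_k}$, and the fundamental ones are $F_\alpha=\sum_{\beta\ge\alpha}M_\beta$. A class function $\chi:\mathfrak{G}\to\mathrm{QSym}$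 can be written uniquely as $\chi=\sum_\alpha \psi_\alpha F_\alpha$ with $\psi_\alpha$ complex class functions on $\mathfrak{G}$; $\chi$ is $F$-effective if every $\psi_\alpha$ is an effective character, i.e. a nonnegative integer combination of irreducible characters of $\mathfrak{G}$. *)

theory Defs
  imports
    "HOL-Algebra.Bij"
    "HOL-Library.Poly_Mapping"
    "HOL-Library.FuncSet"
    "Jordan_Normal_Form.VS_Connect"
begin

section \<open>Double posets\<close>

definition double_poset :: "'a set \<Rightarrow> 'a rel \<Rightarrow> 'a rel \<Rightarrow> bool" where
  "double_poset N le1 le2 \<longleftrightarrow> partial_order_on N le1 \<and> partial_order_on N le2"

definition covers :: "'a rel \<Rightarrow> 'a \<Rightarrow> 'a \<Rightarrow> bool" where
  "covers r y x \<longleftrightarrow> (x, y) \<in> r - Id \<and> (\<nexists>z. (x, z) \<in> r - Id \<and> (z, y) \<in> r - Id)"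

definition locally_special :: "'a set \<Rightarrow> 'a rel \<Rightarrow> 'a rel \<Rightarrow> bool" where
  "locally_special N le1 le2 \<longleftrightarrow>
     (\<forall>x\<in>N. \<forall>y\<in>N. covers le1 y x \<longrightarrow> (x, y) \<in> le2 \<or> (y, x) \<in> le2)"

text \<open>As in \<^theory>\<open>HOL-Algebra.Bij\<close>, permutations of \<open>N\<close> are extensional functions, so that equal
  automorphisms are equal as HOL functions.\<close>

definition dposet_auto :: "'a set \<Rightarrow> 'a rel \<Rightarrow> 'a rel \<Rightarrow> ('a \<Rightarrow> 'a) set" where
  "dposet_auto N le1 le2 =
     {\<sigma> \<in> Bij N. \<forall>x\<in>N. \<forall>y\<in>N. ((x, y) \<in> le1 \<longleftrightarrow> (\<sigma> x, \<sigma> y) \<in> le1) \<and>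
                             ((x, y) \<in> le2 \<longleftrightarrow> (\<sigma> x, \<sigma> y) \<in> le2)}"

lemma subgroup_dposet_auto: "subgroup (dposet_auto N le1 le2) (BijGroup N)"
proof (rule group.subgroupI[OF group_BijGroup])
  show "dposet_auto N le1 le2 \<subseteq> carrier (BijGroup N)"
    by (auto simp: BijGroup_def dposet_auto_def)
  show "dposet_auto N le1 le2 \<noteq> {}"
    using id_Bij[of N] by (auto simp: dposet_auto_def)
next
  fix a assume a: "a \<in> dposet_auto N le1 le2"
  define b where "b = (\<lambda>x\<in>N. inv_into N a x)"
  have aB: "a \<in> Bij N" using a by (simp add: dposet_auto_def)
  have b: "b x \<in> N" "a (b x) = x" if "x \<in> N" for x
    using aB that by (auto simp: b_def Bij_def bij_betw_def inv_into_into f_inv_into_f)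
  have rel: "(x, y) \<in> le1 \<longleftrightarrow> (a x, a y) \<in> le1" "(x, y) \<in> le2 \<longleftrightarrow> (a x, a y) \<in> le2"
    if "x \<in> N" "y \<in> N" for x y
    using a that by (auto simp: dposet_auto_def)
  have "b \<in> Bij N" unfolding b_def by (rule restrict_inv_into_Bij[OF aB])
  moreover have "(x, y) \<in> le1 \<longleftrightarrow> (b x, b y) \<in> le1" "(x, y) \<in> le2 \<longleftrightarrow> (b x, b y) \<in> le2"
    if "x \<in> N" "y \<in> N" for x y
    using rel[of "b x" "b y"] b[OF that(1)] b[OF that(2)] by metis+
  ultimately have "b \<in> dposet_auto N le1 le2" unfolding dposet_auto_def by blast
  thus "inv\<^bsub>BijGroup N\<^esub> a \<in> dposet_auto N le1 le2"
    by (simp add: inv_BijGroup[OF aB] b_def)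
next
  fix a b assume ab: "a \<in> dposet_auto N le1 le2" "b \<in> dposet_auto N le1 le2"
  hence B: "a \<in> Bij N" "b \<in> Bij N" by (simp_all add: dposet_auto_def)
  hence bN: "b x \<in> N" if "x \<in> N" for x using Bij_imp_funcset that by blast
  have "(x, y) \<in> le1 \<longleftrightarrow> (a (b x), a (b y)) \<in> le1" "(x, y) \<in> le2 \<longleftrightarrow> (a (b x), a (b y)) \<in> le2"
    if "x \<in> N" "y \<in> N" for x y
    using ab that bN unfolding dposet_auto_def by blast+
  hence "compose N a b \<in> dposet_auto N le1 le2"
    using compose_Bij[OF B] by (simp add: dposet_auto_def compose_eq)
  thus "a \<otimes>\<^bsub>BijGroup N\<^esub> b \<in> dposet_auto N le1 le2" using B by (simp add: BijGroup_def)
qed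

definition Aut :: "'a set \<Rightarrow> 'a rel \<Rightarrow> 'a rel \<Rightarrow> ('a \<Rightarrow> 'a) monoid" where
  "Aut N le1 le2 = BijGroup N \<lparr>carrier := dposet_auto N le1 le2\<rparr>"

lemma group_Aut: "group (Aut N le1 le2)"
  unfolding Aut_def by (rule subgroup.subgroup_is_group[OF subgroup_dposet_auto group_BijGroup])

definition D_partitions :: "'a set \<Rightarrow> 'a rel \<Rightarrow> 'a rel \<Rightarrow> ('a \<Rightarrow> nat) set" where
  "D_partitions N le1 le2 =
     {f \<in> N \<rightarrow>\<^sub>E {1..}.
        (\<forall>i\<in>N. \<forall>j\<in>N. (i, j) \<in> le1 \<longrightarrow> f i \<le> f j) \<and>
        (\<forall>i\<in>N. \<forall>j\<in>N. (i, j) \<in> le1 - Id \<and> (j, i) \<in> le2 - Id \<longrightarrow> f i < f j)}"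


section \<open>Quasisymmetric functions\<close>

text \<open>A monomial in \<open>x\<^sub>1, x\<^sub>2, \<dots>\<close> is the finitely supported map sending \<open>i\<close> to the exponent of
  \<open>x\<^sub>i\<close> (the index \<open>0\<close> never occurs). A formal power series is its coefficient function.\<close>

type_synonym monom = "nat \<Rightarrow>\<^sub>0 nat"
type_synonym series = "monom \<Rightarrow> complex"

text \<open>The formal sum of the monomials \<open>t s\<close> over \<open>s \<in> S\<close>. It is only used where each monomial
  occurs finitely often, so that \<^const>\<open>card\<close> does count its occurrences.\<close>

definition monomial_sum :: "'s set \<Rightarrow> ('s \<Rightarrow> monom) \<Rightarrow> series" where
  "monomial_sum S t = (\<lambda>m. of_nat (card {s \<in> S. t s = m}))"

definition Omega ::
  "'a set \<Rightarrow> 'a rel \<Rightarrow> 'a rel \<Rightarrow> ('a \<Rightarrow> 'a) \<Rightarrow> series" where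
  "Omega N le1 le2 \<gg> =
     monomial_sum {f \<in> D_partitions N le1 le2. compose N f \<gg> = f}
       (\<lambda>f. \<Sum>v\<in>N. Poly_Mapping.single (f v) 1)"

definition compositions :: "nat list set" where
  "compositions = {\<alpha>. \<forall>a\<in>set \<alpha>. 0 < a}"

text \<open>The order \<open>\<alpha> \<le> \<beta>\<close>: \<open>\<beta>\<close> arises from \<open>\<alpha>\<close> by splitting every part into a composition of it.\<close>

definition refined_by :: "nat list \<Rightarrow> nat list \<Rightarrow> bool" where
  "refined_by \<alpha> \<beta> \<longleftrightarrow> (\<exists>\<gamma>s. concat \<gamma>s = \<beta> \<and> map sum_list \<gamma>s = \<alpha>)"

definition word_monomial :: "nat list \<Rightarrow> nat list \<Rightarrow> monom" where
  "word_monomial i \<alpha> = (\<Sum>j<length \<alpha>. Poly_Mapping.single (i ! j) (\<alpha> ! j))"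

definition monomial_qsym :: "nat list \<Rightarrow> series" where
  "monomial_qsym \<alpha> =
     monomial_sum {i. length i = length \<alpha> \<and> sorted_wrt (<) i \<and> (\<forall>k\<in>set i. 1 \<le> k)}
     (\<lambda>i. word_monomial i \<alpha>)"

definition fundamental_qsym :: "nat list \<Rightarrow> series" where
  "fundamental_qsym \<alpha> = (\<lambda>m. \<Sum>\<beta> | \<beta> \<in> compositions \<and> refined_by \<alpha> \<beta>. monomial_qsym \<beta> m)"


subsection \<open>Linear independence of the fundamental quasisymmetric functions\<close>

lemma lookup_word_monomial:
  assumes "length i = length \<beta>" "distinct i" "l < length \<beta>"
  shows "Poly_Mapping.lookup (word_monomial i \<beta>) (i ! l) = \<beta> ! l"
proof -
  have "Poly_Mapping.lookup (word_monomial i \<beta>) (i ! l) = (\<Sum>j<length \<beta>. if j = l then \<beta> ! j else 0)"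
    unfolding word_monomial_def Poly_Mapping.lookup_sum
    using assms by (intro sum.cong) (auto simp: lookup_single when_def nth_eq_iff_index_eq)
  thus ?thesis using assms by simp
qed

lemma lookup_word_monomial_notin:
  assumes "length i = length \<beta>" "x \<notin> set i"
  shows "Poly_Mapping.lookup (word_monomial i \<beta>) x = 0"
  unfolding word_monomial_def Poly_Mapping.lookup_sum
  using assms by (intro sum.neutral) (auto simp: lookup_single when_def)

lemma word_monomial_inj:
  assumes "length i = length \<alpha>" "length k = length \<beta>" "sorted_wrt (<) i" "sorted_wrt (<) k"
    "\<alpha> \<in> compositions" "\<beta> \<in> compositions" "word_monomial i \<alpha> = word_monomial k \<beta>"
  shows "i = k \<and> \<alpha> = \<beta>"
proof -
  have d: "distinct i" "distinct k" using assms strict_sorted_iff by auto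
  have set: "set i = {x. Poly_Mapping.lookup (word_monomial i \<alpha>) x \<noteq> 0}"
    if "length i = length \<alpha>" "distinct i" "\<alpha> \<in> compositions" for i \<alpha>
  proof (intro equalityI subsetI)
    fix x assume "x \<in> set i"
    then obtain l where "l < length i" "x = i ! l" by (auto simp: in_set_conv_nth)
    with lookup_word_monomial[OF that(1,2), of l] that show "x \<in> {x. Poly_Mapping.lookup (word_monomial i \<alpha>) x \<noteq> 0}"
      by (auto simp: compositions_def)
  next
    fix x assume "x \<in> {x. Poly_Mapping.lookup (word_monomial i \<alpha>) x \<noteq> 0}"
    thus "x \<in> set i" using lookup_word_monomial_notin[OF that(1), of x] by (cases "x \<in> set i") simp_all
  qed
  have "set i = set k"
    unfolding set[OF assms(1) d(1) assms(5)] set[OF assms(2) d(2) assms(6)] assms(7) ..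
  hence ik: "i = k" using assms(3,4) strict_sorted_equal by blast
  moreover have "\<alpha> = \<beta>"
  proof (rule nth_equalityI)
    show "length \<alpha> = length \<beta>" using assms(1,2) ik by simp
    fix l assume "l < length \<alpha>"
    thus "\<alpha> ! l = \<beta> ! l"
      using lookup_word_monomial[OF assms(1) d(1), of l] lookup_word_monomial[OF assms(2) d(2), of l]
        assms(1,2,7) ik by simp
  qed
  ultimately show ?thesis by simp
qed

abbreviation initial_monomial where "initial_monomial \<alpha> \<equiv> word_monomial [Suc 0..<Suc (length \<alpha>)] \<alpha>"

lemma monomial_qsym_initial:
  assumes "\<alpha> \<in> compositions" "\<beta> \<in> compositions"
  shows "monomial_qsym \<beta> (initial_monomial \<alpha>) = (if \<beta> = \<alpha> then 1 else 0)"
proof -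
  have "{s \<in> {i. length i = length \<beta> \<and> sorted_wrt (<) i \<and> (\<forall>k\<in>set i. 1 \<le> k)}. word_monomial s \<beta> = initial_monomial \<alpha>}
     = (if \<beta> = \<alpha> then {[Suc 0..<Suc (length \<alpha>)]} else {})"
    using word_monomial_inj[of _ \<beta> "[Suc 0..<Suc (length \<alpha>)]" \<alpha>] assms by (auto simp del: upt_Suc)
  thus ?thesis by (simp add: monomial_qsym_def monomial_sum_def del: upt_Suc)
qed

lemma finite_refinements:
  shows "finite {\<beta>. \<beta> \<in> compositions \<and> refined_by \<alpha> \<beta>}"
proof (rule finite_subset)
  have sc: "sum_list (map sum_list bs) = sum_list (concat bs)" for bs :: "nat list list"
    by (induction bs) auto
  have s: "sum_list \<alpha> = sum_list \<beta>" if "refined_by \<alpha> \<beta>" for \<beta>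
    using that unfolding refined_by_def
    by (elim exE conjE, hypsubst) (rule sc)
  have l: "length \<beta> \<le> sum_list \<beta>" if "\<beta> \<in> compositions" for \<beta> using that
    by (induction \<beta>) (auto simp: compositions_def Suc_le_eq add_mono)
  show "{\<beta>. \<beta> \<in> compositions \<and> refined_by \<alpha> \<beta>} \<subseteq> {xs. set xs \<subseteq> {..sum_list \<alpha>} \<and> length xs \<le> sum_list \<alpha>}"
    using s l by (auto dest: member_le_sum_list)
  show "finite {xs. set xs \<subseteq> {..sum_list \<alpha>} \<and> length xs \<le> sum_list \<alpha>}"
    by (rule finite_lists_length_le) simp
qed

lemma fundamental_qsym_initial:
  assumes "\<beta> \<in> compositions"
  shows "fundamental_qsym \<alpha> (initial_monomial \<beta>) = (if refined_by \<alpha> \<beta> then 1 else 0)"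
  unfolding fundamental_qsym_def using assms finite_refinements
  by (subst sum.cong[OF refl, of _ _ "\<lambda>\<gamma>. if \<gamma> = \<beta> then 1 else 0"]) (auto simp: monomial_qsym_initial simp del: upt_Suc)

lemma length_concat_blocks: assumes "\<forall>b\<in>set bs. 0 < sum_list (b::nat list)"
  shows "length bs \<le> length (concat bs) \<and> (length bs = length (concat bs) \<longrightarrow> map sum_list bs = concat bs)"
  using assms
proof (induction bs)
  case (Cons b bs)
  then obtain x b' where "b = x # b'" by (cases b) auto
  thus ?case using Cons by auto
qed simp

lemma refined_by_length: assumes "\<alpha> \<in> compositions" "refined_by \<alpha> \<beta>"
  shows "length \<alpha> \<le> length \<beta> \<and> (length \<alpha> = length \<beta> \<longrightarrow> \<alpha> = \<beta>)"
  using assms length_concat_blocks by (fastforce simp: refined_by_def compositions_def)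

lemma refined_by_refl: "refined_by \<alpha> \<alpha>"
  unfolding refined_by_def by (rule exI[of _ "map (\<lambda>x. [x]) \<alpha>"]) (induction \<alpha>, auto)

lemma fundamental_qsym_independent:
  assumes "finite A" "A \<subseteq> compositions" "\<forall>m. (\<Sum>\<alpha>\<in>A. c \<alpha> * fundamental_qsym \<alpha> m) = 0" "\<alpha> \<in> A"
  shows "c \<alpha> = 0"
  using assms(4)
proof (induction "length \<alpha>" arbitrary: \<alpha> rule: less_induct)
  case less
  have "0 = (\<Sum>\<gamma>\<in>A. c \<gamma> * fundamental_qsym \<gamma> (initial_monomial \<alpha>))" using assms(3) by simp
  also have "\<dots> = (\<Sum>\<gamma>\<in>A. if \<gamma> = \<alpha> then c \<alpha> else 0)"
  proof (rule sum.cong[OF refl])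
    fix \<gamma> assume g: "\<gamma> \<in> A"
    have "c \<gamma> = 0" if "refined_by \<gamma> \<alpha>" "\<gamma> \<noteq> \<alpha>"
      using that refined_by_length[of \<gamma> \<alpha>] g assms(2) less.hyps[of \<gamma>] by force
    then show "c \<gamma> * fundamental_qsym \<gamma> (initial_monomial \<alpha>) = (if \<gamma> = \<alpha> then c \<alpha> else 0)"
      using fundamental_qsym_initial[of \<alpha> \<gamma>] subsetD[OF assms(2) less.prems]
      by (cases "\<gamma> = \<alpha>") (auto simp: refined_by_refl simp del: upt_Suc)
  qed
  finally show ?case using assms less by simp
qed


section \<open>Complex characters\<close>

text \<open>A representation of degree \<open>n\<close> is a homomorphism into the unit group of the ring of complex
  \<open>n \<times> n\<close> matrices.\<close>

definition representation :: "('g, 'b) monoid_scheme \<Rightarrow> nat \<Rightarrow> ('g \<Rightarrow> complex mat) \<Rightarrow> bool" where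
  "representation G n \<rho> \<longleftrightarrow> \<rho> \<in> hom G (units_of (ring_mat TYPE(complex) n ()))"

definition irreducible_representation ::
  "('g, 'b) monoid_scheme \<Rightarrow> nat \<Rightarrow> ('g \<Rightarrow> complex mat) \<Rightarrow> bool" where
  "irreducible_representation G n \<rho> \<longleftrightarrow>
     representation G n \<rho> \<and> 0 < n \<and>
     (\<forall>W. subspace class_ring W (module_vec TYPE(complex) n) \<and>
          (\<forall>g\<in>carrier G. \<forall>w\<in>W. \<rho> g *\<^sub>v w \<in> W)
          \<longrightarrow> W = {0\<^sub>v n} \<or> W = carrier_vec n)"

definition character :: "('g, 'b) monoid_scheme \<Rightarrow> nat \<Rightarrow> ('g \<Rightarrow> complex mat) \<Rightarrow> 'g \<Rightarrow> complex" where
  "character G n \<rho> = (\<lambda>g\<in>carrier G. \<Sum>i<n. \<rho> g $$ (i, i))"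

definition irreducible_characters :: "('g, 'b) monoid_scheme \<Rightarrow> ('g \<Rightarrow> complex) set" where
  "irreducible_characters G = {character G n \<rho> | n \<rho>. irreducible_representation G n \<rho>}"

definition effective_character :: "('g, 'b) monoid_scheme \<Rightarrow> ('g \<Rightarrow> complex) \<Rightarrow> bool" where
  "effective_character G \<psi> \<longleftrightarrow>
     (\<exists>I c. finite I \<and> I \<subseteq> irreducible_characters G \<and>
        (\<forall>g\<in>carrier G. \<psi> g = (\<Sum>\<chi>\<in>I. of_nat (c \<chi> :: nat) * \<chi> g)))"

definition class_function :: "('g, 'b) monoid_scheme \<Rightarrow> ('g \<Rightarrow> complex) \<Rightarrow> bool" where
  "class_function G \<psi> \<longleftrightarrow>
     (\<forall>g\<in>carrier G. \<forall>h\<in>carrier G. \<psi> (h \<otimes>\<^bsub>G\<^esub> g \<otimes>\<^bsub>G\<^esub> inv\<^bsub>G\<^esub> h) = \<psi> g)"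


section \<open>F-effectiveness\<close>

text \<open>The expansion \<open>\<chi> = (\<Sum>\<alpha>. \<psi>\<^sub>\<alpha> F\<^sub>\<alpha>)\<close>. The sum over all compositions is finite, as quasisymmetric
  functions have bounded degree; an expansion exists only if \<open>\<chi>\<close> is a class function with values in
  QSym.\<close>

definition F_expansion ::
  "('g, 'b) monoid_scheme \<Rightarrow> ('g \<Rightarrow> series) \<Rightarrow> (nat list \<Rightarrow> 'g \<Rightarrow> complex) \<Rightarrow> bool" where
  "F_expansion G \<chi> \<psi> \<longleftrightarrow>
     (\<forall>\<alpha>\<in>compositions. class_function G (\<psi> \<alpha>)) \<and>
     finite {\<alpha> \<in> compositions. \<exists>g\<in>carrier G. \<psi> \<alpha> g \<noteq> 0} \<and>
     (\<forall>g\<in>carrier G. \<forall>m. \<chi> g m =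
        (\<Sum>\<alpha> | \<alpha> \<in> compositions \<and> (\<exists>h\<in>carrier G. \<psi> \<alpha> h \<noteq> 0). \<psi> \<alpha> g * fundamental_qsym \<alpha> m))"

lemma F_expansion_unique:
  assumes "F_expansion G \<chi> \<psi>" "F_expansion G \<chi> \<psi>'" "\<alpha> \<in> compositions" "g \<in> carrier G"
  shows "\<psi> \<alpha> g = \<psi>' \<alpha> g"
proof -
  define S where "S = (\<lambda>\<psi>::nat list \<Rightarrow> 'a \<Rightarrow> complex. {\<alpha> \<in> compositions. \<exists>g\<in>carrier G. \<psi> \<alpha> g \<noteq> 0})"
  define A where "A = insert \<alpha> (S \<psi> \<union> S \<psi>')"
  have A: "finite A" "A \<subseteq> compositions" using assms by (auto simp: A_def S_def F_expansion_def)
  have e: "\<chi> g m = (\<Sum>\<alpha>\<in>A. \<phi> \<alpha> g * fundamental_qsym \<alpha> m)"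
    if "F_expansion G \<chi> \<phi>" "S \<phi> \<subseteq> A" for \<phi> m
  proof -
    have "\<chi> g m = (\<Sum>\<alpha>\<in>S \<phi>. \<phi> \<alpha> g * fundamental_qsym \<alpha> m)"
      using that assms(4) by (simp add: F_expansion_def S_def)
    also have "\<dots> = (\<Sum>\<alpha>\<in>A. \<phi> \<alpha> g * fundamental_qsym \<alpha> m)"
      by (rule sum.mono_neutral_left) (use A that assms(4) in \<open>auto simp: S_def\<close>)
    finally show ?thesis .
  qed
  have z: "\<forall>m. (\<Sum>\<alpha>\<in>A. (\<psi> \<alpha> g - \<psi>' \<alpha> g) * fundamental_qsym \<alpha> m) = 0"
    using e[OF assms(1)] e[OF assms(2)] by (simp add: A_def left_diff_distrib sum_subtractf subset_insertI2)
  from fundamental_qsym_independent[OF A z, of \<alpha>] show ?thesis by (simp add: A_def)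
qed

definition F_effective :: "('g, 'b) monoid_scheme \<Rightarrow> ('g \<Rightarrow> series) \<Rightarrow> bool" where
  "F_effective G \<chi> \<longleftrightarrow>
     (\<exists>\<psi>. F_expansion G \<chi> \<psi> \<and> (\<forall>\<alpha>\<in>compositions. effective_character G (\<psi> \<alpha>)))"

end

theory Submission
  imports Defs "HOL-Library.Function_Algebras" "HOL-Library.Indicator_Function"
begin

text \<open>Let \<open>L\<close> be the set of linear extensions of \<open>\<le>\<^sub>1\<close>, seen as bijections onto \<open>{1..n}\<close>. A set
  \<open>S\<close> of cut positions groups \<open>L\<close> into classes (two extensions are equivalent if they have the same
  initial segments of the sizes in \<open>S\<close>), and the classes whose cuts separate the strict relations
  correspond to the \<open>D\<close>-partitions with block sizes given by \<open>S\<close>. Let \<open>U\<^sub>S\<close> be the span of the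
  indicator functions of these classes; it is a permutation representation inside the functions on
  \<open>L\<close>, and \<open>U\<^sub>S \<subseteq> U\<^sub>T\<close> for \<open>S \<subseteq> T\<close>.

  Fix a linear extension \<open>\<omega>\<close> of \<open>\<le>\<^sub>2\<close> and let \<open>b\<^sub>l\<close> be the indicator of the class of \<open>l\<close> for its own
  descent set. The \<open>b\<^sub>l\<close> are unitriangular with respect to inversions, hence independent, and since
  \<open>D\<close> is locally special each class for \<open>S\<close> contains an extension with descents in \<open>S\<close>; by counting,
  the \<open>b\<^sub>l\<close> with descents in \<open>S\<close> form a basis of \<open>U\<^sub>S\<close>. In the basis of all \<open>b\<^sub>l\<close> the group therefore
  acts by matrices that are block triangular along the descent sets. The trace \<open>\<psi>\<^sub>T\<close> of the diagonal
  block for the descent set \<open>T\<close> is a character, and the permutation character of \<open>U\<^sub>S\<close> is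
  \<open>\<Sum>T\<subseteq>S. \<psi>\<^sub>T\<close>, so the \<open>\<psi>\<^sub>T\<close> are the coefficients of the \<open>F\<close>-expansion. Passing to diagonal blocks
  along a composition series likewise shows that every character is a sum of irreducible ones.\<close>

section \<open>Traces and block triangular actions\<close>

text \<open>Rows and columns are indexed by an arbitrary finite set, so that part of a basis can
  serve as index set without being enumerated. Over a group, invertibility follows from the values
  at the unit and at products.\<close>

definition indexed_representation ::
  "('g, 'b) monoid_scheme \<Rightarrow> 'j set \<Rightarrow> ('g \<Rightarrow> 'j \<Rightarrow> 'j \<Rightarrow> 'k::comm_ring_1) \<Rightarrow> bool" where
  "indexed_representation G J c \<longleftrightarrow> finite J \<and>
     (\<forall>i\<in>J. \<forall>j\<in>J. c \<one>\<^bsub>G\<^esub> i j = (if i = j then 1 else 0)) \<and>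
     (\<forall>g\<in>carrier G. \<forall>h\<in>carrier G. \<forall>i\<in>J. \<forall>j\<in>J. c (g \<otimes>\<^bsub>G\<^esub> h) i j = (\<Sum>k\<in>J. c g i k * c h k j))"

context vector_space
begin

lemma linear_combination:
  assumes "Vector_Spaces.linear scale scale T"
  shows "T (\<Sum>b\<in>B. r b *s b) = (\<Sum>b\<in>B. r b *s T b)"
proof -
  interpret T: Vector_Spaces.linear scale scale T by fact
  show ?thesis by (simp add: T.sum T.scale)
qed

lemma linear_image_span_subset:
  assumes "Vector_Spaces.linear scale scale T" "\<And>b. b \<in> B \<Longrightarrow> T b \<in> span C" "v \<in> span B"
  shows "T v \<in> span C"
proof -
  interpret T: Vector_Spaces.linear scale scale T by fact
  have "T ` span B = span (T ` B)" by (rule T.span_image [symmetric])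
  also have "\<dots> \<subseteq> span C" using assms(2) by (intro span_minimal) auto
  finally show ?thesis using assms(3) by blast
qed

lemma representation_combination:
  assumes "independent B" "\<And>c. c \<in> C \<Longrightarrow> f c \<in> span B"
  shows "representation B (\<Sum>c\<in>C. r c *s f c) b = (\<Sum>c\<in>C. r c * representation B (f c) b)"
  using assms by (simp add: representation_sum representation_scale span_scale)

text \<open>Expanding \<open>T b\<close> through the \<open>T c\<close>, and \<open>T c\<close>
  through the \<open>b\<close>, turns both traces into the same double sum. It is the trace of the
  restriction of \<open>T\<close> to the common span.\<close>

lemma trace_basis_independent:
  assumes "finite B" "finite C" "independent B" "independent C" "span B = span C"
    and T: "Vector_Spaces.linear scale scale T" "\<And>b. b \<in> B \<Longrightarrow> T b \<in> span B"
  shows "(\<Sum>b\<in>B. representation B (T b) b) = (\<Sum>c\<in>C. representation C (T c) c)"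
proof -
  have TC: "T c \<in> span B" if "c \<in> C" for c
    using linear_image_span_subset[OF T] that assms(5) by (simp add: span_base)
  have b: "T b = (\<Sum>c\<in>C. representation C b c *s T c)" if "b \<in> B" for b
    using linear_combination[OF T(1), of "representation C b" C] that assms(2,4,5)
    by (metis order_refl span_base sum_representation_eq)
  have c: "T c = (\<Sum>b\<in>B. representation B (T c) b *s b)" if "c \<in> C" for c
    using TC[OF that] assms(1,3) by (simp add: sum_representation_eq)
  have "(\<Sum>b\<in>B. representation B (T b) b) = (\<Sum>b\<in>B. \<Sum>c\<in>C. representation C b c * representation B (T c) b)"
  proof (rule sum.cong[OF refl])
    fix b assume "b \<in> B"
    then have "representation B (T b) b
        = representation B (\<Sum>c\<in>C. representation C b c *s T c) b" using b by simp
    then show "representation B (T b) b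
        = (\<Sum>c\<in>C. representation C b c * representation B (T c) b)"
      using TC assms(3) by (simp add: representation_combination)
  qed
  also have "\<dots> = (\<Sum>c\<in>C. \<Sum>b\<in>B. representation B (T c) b * representation C b c)"
    by (subst sum.swap) (simp add: mult.commute)
  also have "\<dots> = (\<Sum>c\<in>C. representation C (T c) c)"
  proof (rule sum.cong[OF refl])
    fix c assume "c \<in> C"
    then have "representation C (T c) c
        = representation C (\<Sum>b\<in>B. representation B (T c) b *s b) c" using c by simp
    then show "(\<Sum>b\<in>B. representation B (T c) b * representation C b c) = representation C (T c) c"
      using assms(4,5) span_base[of _ B] by (simp add: representation_combination)
  qed
  finally show ?thesis .
qed

lemma representation_nonzero_span:
  assumes "independent B" "C \<subseteq> B" "v \<in> span C" "representation B v b \<noteq> 0"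
  shows "b \<in> C"
  using assms representation_extend[of B v C] representation_ne_zero by metis

text \<open>By \<open>tri\<close> the matrices of the action are block triangular along \<open>w\<close>, so their diagonal blocks are
  multiplicative.\<close>

lemma block_indexed_representation:
  fixes w :: "'b \<Rightarrow> 'w::order"
  assumes G: "monoid G" and B: "finite B" "independent B"
    and lin: "\<And>g. g \<in> carrier G \<Longrightarrow> Vector_Spaces.linear scale scale (A g)"
    and tri: "\<And>g b. g \<in> carrier G \<Longrightarrow> b \<in> B \<Longrightarrow> A g b \<in> span {b' \<in> B. w b' \<le> w b}"
    and one: "\<And>b. b \<in> B \<Longrightarrow> A \<one>\<^bsub>G\<^esub> b = b"
    and mult: "\<And>g h b. g \<in> carrier G \<Longrightarrow> h \<in> carrier G \<Longrightarrow> b \<in> B \<Longrightarrow> A (g \<otimes>\<^bsub>G\<^esub> h) b = A g (A h b)"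
  shows "indexed_representation G {b \<in> B. w b = t} (\<lambda>g b' b. representation B (A g b) b')"
  unfolding indexed_representation_def
proof (intro conjI ballI)
  show "finite {b \<in> B. w b = t}" using B by simp
next
  fix i j assume "i \<in> {b \<in> B. w b = t}" "j \<in> {b \<in> B. w b = t}"
  then show "representation B (A \<one>\<^bsub>G\<^esub> j) i = (if i = j then 1 else 0)"
    using one B by (auto simp: representation_basis)
next
  fix g h i j
  assume gh: "g \<in> carrier G" "h \<in> carrier G" and ij: "i \<in> {b \<in> B. w b = t}" "j \<in> {b \<in> B. w b = t}"
  have sp: "A k b \<in> span B" if "k \<in> carrier G" "b \<in> B" for k b
    using tri[OF that] span_mono[of "{b' \<in> B. w b' \<le> w b}" B] by auto
  have nz: "w b' \<le> w b" if "k \<in> carrier G" "b \<in> B" "representation B (A k b) b' \<noteq> 0" for k b b'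
    using representation_nonzero_span[OF B(2) _ tri[OF that(1,2)] that(3)] by auto
  have "A (g \<otimes>\<^bsub>G\<^esub> h) j = A g (\<Sum>b\<in>B. representation B (A h j) b *s b)"
    using mult[OF gh] ij sp[OF gh(2)] B by (simp add: sum_representation_eq)
  also have "\<dots> = (\<Sum>b\<in>B. representation B (A h j) b *s A g b)"
    by (rule linear_combination[OF lin[OF gh(1)]])
  finally have "representation B (A (g \<otimes>\<^bsub>G\<^esub> h) j) i
      = (\<Sum>b\<in>B. representation B (A h j) b * representation B (A g b) i)"
    using sp[OF gh(1)] B by (simp add: representation_combination)
  \<comment> \<open>A term survives only if \<open>w b \<le> w j = t\<close> and
    \<open>t = w i \<le> w b\<close>, so antisymmetry confines the sum to the block.\<close>
  also have "\<dots> = (\<Sum>b\<in>{b \<in> B. w b = t}. representation B (A h j) b * representation B (A g b) i)"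
  proof (rule sum.mono_neutral_right)
    show "\<forall>b\<in>B - {b \<in> B. w b = t}. representation B (A h j) b * representation B (A g b) i = 0"
    proof
      fix b assume b: "b \<in> B - {b \<in> B. w b = t}"
      show "representation B (A h j) b * representation B (A g b) i = 0"
        using nz[OF gh(2), of j b] nz[OF gh(1), of b i] b ij by fastforce
    qed
  qed (use B in auto)
  finally show "representation B (A (g \<otimes>\<^bsub>G\<^esub> h) j) i
      = (\<Sum>k\<in>{b \<in> B. w b = t}. representation B (A g k) i * representation B (A h j) k)"
    by (simp add: mult.commute)
qed

end

text \<open>Together with pointwise addition this makes the functions into a field a vector space,
  the ambient space of every later span.\<close>

definition fun_scale :: "'k::field \<Rightarrow> ('x \<Rightarrow> 'k) \<Rightarrow> 'x \<Rightarrow> 'k" where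
  "fun_scale c f = (\<lambda>x. c * f x)"

lemma fun_scale_apply [simp]: "fun_scale c f x = c * f x"
  by (simp add: fun_scale_def)

lemma sum_fun_apply: "(\<Sum>i\<in>I. f i) x = (\<Sum>i\<in>I. f i x)"
  by (induction I rule: infinite_finite_induct) auto

interpretation fv: vector_space "fun_scale :: 'k::field \<Rightarrow> ('x \<Rightarrow> 'k) \<Rightarrow> 'x \<Rightarrow> 'k"
  by standard (auto simp: fun_eq_iff algebra_simps)

section \<open>Effective characters\<close>

lemma effective_character_cong:
  assumes "effective_character G \<phi>" "\<And>g. g \<in> carrier G \<Longrightarrow> \<psi> g = \<phi> g"
  shows "effective_character G \<psi>"
  using assms by (simp add: effective_character_def)

lemma effective_character_zero: "effective_character G (\<lambda>g. 0)"
  unfolding effective_character_def by (intro exI[of _ "{}"]) simp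

lemma effective_character_add:
  assumes "effective_character G \<phi>" "effective_character G \<psi>"
  shows "effective_character G (\<lambda>g. \<phi> g + \<psi> g)"
proof -
  obtain I c where I: "finite I" "I \<subseteq> irreducible_characters G"
      "\<forall>g\<in>carrier G. \<phi> g = (\<Sum>\<chi>\<in>I. of_nat (c \<chi> :: nat) * \<chi> g)"
    using assms(1) by (auto simp: effective_character_def)
  obtain J d where J: "finite J" "J \<subseteq> irreducible_characters G"
      "\<forall>g\<in>carrier G. \<psi> g = (\<Sum>\<chi>\<in>J. of_nat (d \<chi> :: nat) * \<chi> g)"
    using assms(2) by (auto simp: effective_character_def)
  \<comment> \<open>The two families of irreducible characters may overlap: multiplicities are
    extended by 0 outside their own family and then added.\<close>
  define e where "e \<chi> = (if \<chi> \<in> I then c \<chi> else 0) + (if \<chi> \<in> J then d \<chi> else 0)" for \<chi>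
  have "\<phi> g + \<psi> g = (\<Sum>\<chi>\<in>I \<union> J. of_nat (e \<chi>) * \<chi> g)" if "g \<in> carrier G" for g
  proof -
    have "\<phi> g = (\<Sum>\<chi>\<in>I \<union> J. of_nat (if \<chi> \<in> I then c \<chi> else 0) * \<chi> g)"
      using I(3) that by (auto intro!: sum.mono_neutral_cong_left simp: I J)
    moreover have "\<psi> g = (\<Sum>\<chi>\<in>I \<union> J. of_nat (if \<chi> \<in> J then d \<chi> else 0) * \<chi> g)"
      using J(3) that by (auto intro!: sum.mono_neutral_cong_left simp: I J)
    ultimately show ?thesis by (simp add: e_def sum.distrib distrib_right)
  qed
  then show ?thesis
    unfolding effective_character_def using I J by (intro exI[of _ "I \<union> J"] exI[of _ e]) auto
qed

section \<open>Traces and matrices of indexed representations\<close>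

lemma indexed_representation_reindex:
  assumes "indexed_representation G J c" "bij_betw f I J"
  shows "indexed_representation G I (\<lambda>g i j. c g (f i) (f j))"
proof -
  have "finite I" using assms bij_betw_finite by (auto simp: indexed_representation_def)
  moreover have "f i \<in> J" if "i \<in> I" for i using assms(2) that by (auto simp: bij_betw_def)
  moreover have "f i = f j \<longleftrightarrow> i = j" if "i \<in> I" "j \<in> I" for i j
    using assms(2) that by (auto simp: bij_betw_def inj_on_def)
  moreover have "(\<Sum>k\<in>J. c g (f i) k * c h k (f j)) = (\<Sum>k\<in>I. c g (f i) (f k) * c h (f k) (f j))" for g h i j
    by (rule sum.reindex_bij_betw[OF assms(2), symmetric])
  ultimately show ?thesis using assms(1) by (simp add: indexed_representation_def)
qed

text \<open>The trace of a product does not depend on the order of the two factors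
  (\<open>swap\<close>), so conjugation cancels.\<close>

lemma class_function_trace:
  fixes c :: "'g \<Rightarrow> 'j \<Rightarrow> 'j \<Rightarrow> complex"
  assumes "group G" "indexed_representation G J c"
  shows "class_function G (\<lambda>g. \<Sum>i\<in>J. c g i i)"
  unfolding class_function_def
proof (intro ballI)
  fix g h assume gh: "g \<in> carrier G" "h \<in> carrier G"
  interpret group G by fact
  have m: "c (a \<otimes>\<^bsub>G\<^esub> b) i j = (\<Sum>k\<in>J. c a i k * c b k j)"
    if "a \<in> carrier G" "b \<in> carrier G" "i \<in> J" "j \<in> J" for a b i j
    using assms(2) that by (simp add: indexed_representation_def)
  have swap: "(\<Sum>i\<in>J. c (a \<otimes>\<^bsub>G\<^esub> b) i i) = (\<Sum>i\<in>J. c (b \<otimes>\<^bsub>G\<^esub> a) i i)"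
    if "a \<in> carrier G" "b \<in> carrier G" for a b
    using that by (simp add: m, subst sum.swap, simp add: mult.commute)
  have "(\<Sum>i\<in>J. c (h \<otimes>\<^bsub>G\<^esub> g \<otimes>\<^bsub>G\<^esub> inv\<^bsub>G\<^esub> h) i i) = (\<Sum>i\<in>J. c (inv\<^bsub>G\<^esub> h \<otimes>\<^bsub>G\<^esub> (h \<otimes>\<^bsub>G\<^esub> g)) i i)"
    using gh by (intro swap) auto
  then show "(\<Sum>i\<in>J. c (h \<otimes>\<^bsub>G\<^esub> g \<otimes>\<^bsub>G\<^esub> inv\<^bsub>G\<^esub> h) i i) = (\<Sum>i\<in>J. c g i i)"
    using gh by (simp add: m_assoc[symmetric])
qed

text \<open>The matrix of the inverse group element is a two-sided inverse, which places every
  matrix in the unit group.\<close>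

lemma representation_mat:
  fixes c :: "'g \<Rightarrow> nat \<Rightarrow> nat \<Rightarrow> complex"
  assumes "group G" "indexed_representation G {..<n} c"
  shows "Defs.representation G n (\<lambda>g. mat n n (\<lambda>(i, j). c g i j))"
proof -
  interpret group G by fact
  let ?\<rho> = "\<lambda>g. mat n n (\<lambda>(i, j). c g i j)"
  have mult: "?\<rho> (g \<otimes>\<^bsub>G\<^esub> h) = ?\<rho> g * ?\<rho> h" if "g \<in> carrier G" "h \<in> carrier G" for g h
    using assms(2) that
    by (intro eq_matI) (auto simp: indexed_representation_def scalar_prod_def lessThan_atLeast0)
  have one: "?\<rho> \<one>\<^bsub>G\<^esub> = 1\<^sub>m n"
    using assms(2) by (intro eq_matI) (auto simp: indexed_representation_def)
  have unit: "?\<rho> g \<in> Units (ring_mat TYPE(complex) n ())" if "g \<in> carrier G" for g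
    unfolding Units_def ring_mat_simps
    using mult[of g "inv\<^bsub>G\<^esub> g"] mult[of "inv\<^bsub>G\<^esub> g" g] one that
    by (auto intro!: bexI[of _ "?\<rho> (inv\<^bsub>G\<^esub> g)"])
  show ?thesis
    unfolding Defs.representation_def
    by (rule homI) (use mult unit in \<open>auto simp: units_of_def ring_mat_simps\<close>)
qed

text \<open>The functions vanishing from \<open>n\<close> on serve as the copy of
  \<open>n\<close>-dimensional space inside the function space.\<close>

lemma fv_span_unit_vectors:
  "fv.span ((\<lambda>i j. if j = i then 1 else 0 :: 'k::field) ` {..<n::nat}) = {\<phi>. \<forall>i\<ge>n. \<phi> i = 0}"
    (is "fv.span (?e ` _) = ?V")
proof (rule fv.span_unique)
  show "fv.subspace ?V" by (auto simp: fv.subspace_def)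
  fix T assume T: "?e ` {..<n} \<subseteq> T" "fv.subspace T"
  show "?V \<subseteq> T"
  proof
    fix \<phi> :: "nat \<Rightarrow> 'k" assume \<phi>: "\<phi> \<in> ?V"
    have "(\<Sum>i<n. fun_scale (\<phi> i) (?e i)) x = \<phi> x" for x
    proof -
      have "(\<Sum>i<n. fun_scale (\<phi> i) (?e i)) x = (\<Sum>i<n. if i = x then \<phi> x else 0)"
        unfolding sum_fun_apply by (intro sum.cong) auto
      also have "\<dots> = \<phi> x" using \<phi> by simp
      finally show ?thesis .
    qed
    then have "\<phi> = (\<Sum>i<n. fun_scale (\<phi> i) (?e i))" by auto
    also have "\<dots> \<in> T" using T by (intro fv.subspace_sum fv.subspace_scale) auto
    finally show "\<phi> \<in> T" .
  qed
qed auto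

text \<open>Unfolds reducibility into plain closure properties of a set of vectors, which are easy
  to carry over to a space of functions.\<close>

lemma proper_invariant_subspace:
  assumes "Defs.representation G n \<rho>" "0 < n" "\<not> irreducible_representation G n \<rho>"
  obtains W where "W \<subseteq> carrier_vec n" "0\<^sub>v n \<in> W" "\<And>v w. v \<in> W \<Longrightarrow> w \<in> W \<Longrightarrow> v + w \<in> W"
    "\<And>a v. v \<in> W \<Longrightarrow> a \<cdot>\<^sub>v v \<in> W" "\<And>g w. g \<in> carrier G \<Longrightarrow> w \<in> W \<Longrightarrow> \<rho> g *\<^sub>v w \<in> W"
    "W \<noteq> {0\<^sub>v n}" "W \<noteq> carrier_vec n"
proof -
  obtain W where W: "VectorSpace.subspace class_ring W (module_vec TYPE(complex) n)"
      "\<And>g w. g \<in> carrier G \<Longrightarrow> w \<in> W \<Longrightarrow> \<rho> g *\<^sub>v w \<in> W" "W \<noteq> {0\<^sub>v n}" "W \<noteq> carrier_vec n"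
    using assms unfolding irreducible_representation_def by blast
  then interpret submodule class_ring W "module_vec TYPE(complex) n" by (simp add: VectorSpace.subspace_def)
  show thesis
    using that[of W] W subset m_closed zero_closed smult_closed
    by (simp add: module_vec_simps class_ring_simps)
qed

text \<open>Strong induction on the degree. In the reducible case a basis \<open>C\<close> of an
  invariant subspace \<open>U\<close>, extended to a basis \<open>B\<close> of the whole space
  \<open>V\<close>, makes all matrices block triangular. The trace is then the sum of the traces on
  \<open>U\<close> and on \<open>V\<close> modulo \<open>U\<close>, both of smaller degree.\<close>

lemma effective_character_trace_lessThan:
  fixes c :: "'g \<Rightarrow> nat \<Rightarrow> nat \<Rightarrow> complex"
  assumes "group G" "indexed_representation G {..<n} c"
  shows "effective_character G (\<lambda>g. \<Sum>i<n. c g i i)"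
  using assms(2)
proof (induction n arbitrary: c rule: less_induct)
  case (less n)
  interpret group G by fact
  define \<rho> where "\<rho> g = mat n n (\<lambda>(i, j). c g i j)" for g
  have \<rho>: "Defs.representation G n \<rho>"
    unfolding \<rho>_def by (rule representation_mat[OF assms(1) less.prems])
  consider "n = 0" | "irreducible_representation G n \<rho>" | "0 < n" "\<not> irreducible_representation G n \<rho>"
    by auto
  then show ?case
  proof cases
    case 1
    then show ?thesis by (simp add: effective_character_zero)
  next
    case 2
    then have "character G n \<rho> \<in> irreducible_characters G" by (auto simp: irreducible_characters_def)
    moreover have "(\<Sum>i<n. c g i i) = character G n \<rho> g" if "g \<in> carrier G" for g
      using that by (auto simp: character_def \<rho>_def)
    ultimately show ?thesis
      unfolding effective_character_def
      by (intro exI[of _ "{character G n \<rho>}"] exI[of _ "\<lambda>_. 1"]) auto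
  next
    case 3
    obtain W where W: "W \<subseteq> carrier_vec n" "0\<^sub>v n \<in> W" "\<And>v w. v \<in> W \<Longrightarrow> w \<in> W \<Longrightarrow> v + w \<in> W"
        "\<And>a v. v \<in> W \<Longrightarrow> a \<cdot>\<^sub>v v \<in> W" "\<And>g w. g \<in> carrier G \<Longrightarrow> w \<in> W \<Longrightarrow> \<rho> g *\<^sub>v w \<in> W"
        "W \<noteq> {0\<^sub>v n}" "W \<noteq> carrier_vec n"
      using proper_invariant_subspace[OF \<rho> 3] by blast
    \<comment> \<open>\<open>emb\<close> turns vectors into functions supported below
      \<open>n\<close>; there \<open>A g\<close> is the action of \<open>\<rho> g\<close>, and
      \<open>U\<close> is the image of \<open>W\<close>.\<close>
    define emb where "emb v = (\<lambda>i. if i < n then v $ i else 0)" for v :: "complex vec"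
    define e where "e i = (\<lambda>j. if j = i then 1 else 0 :: complex)" for i :: nat
    define V :: "(nat \<Rightarrow> complex) set" where "V = {\<phi>. \<forall>i\<ge>n. \<phi> i = 0}"
    define A where "A g \<phi> = (\<lambda>i. if i < n then \<Sum>j<n. c g i j * \<phi> j else 0)" for g \<phi>
    define U where "U = emb ` W"
    have V: "fv.span (e ` {..<n}) = V"
      using fv_span_unit_vectors[of n, where ?'k = complex] by (simp add: e_def[abs_def] V_def)
    have subV: "fv.subspace V" unfolding V[symmetric] by (rule fv.subspace_span)
    have inj_e: "inj_on e {..<n}" by (auto simp: inj_on_def e_def fun_eq_iff split: if_splits)
    have emb_V: "emb ` carrier_vec n = V"
    proof
      show "V \<subseteq> emb ` carrier_vec n"
      proof
        fix \<phi> assume "\<phi> \<in> V"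
        then have "\<phi> = emb (vec n \<phi>)" by (auto simp: V_def emb_def)
        then show "\<phi> \<in> emb ` carrier_vec n" by (metis imageI vec_carrier)
      qed
    qed (auto simp: V_def emb_def)
    have inj_emb: "inj_on emb (carrier_vec n)"
      by (auto simp: inj_on_def emb_def fun_eq_iff intro!: eq_vecI split: if_splits)
    have UV: "U \<subseteq> V" using emb_V W(1) by (auto simp: U_def)
    have emb_add: "emb (v + w) = emb v + emb w" if "v \<in> carrier_vec n" "w \<in> carrier_vec n" for v w
      using that by (auto simp: emb_def fun_eq_iff)
    have emb_smult: "emb (a \<cdot>\<^sub>v v) = fun_scale a (emb v)" if "v \<in> carrier_vec n" for v a
      using that by (auto simp: emb_def fun_eq_iff)
    have emb_zero: "emb (0\<^sub>v n) = 0" by (auto simp: emb_def fun_eq_iff)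
    have subU: "fv.subspace U"
    proof (rule fv.subspaceI)
      show "0 \<in> U" using imageI[OF W(2), of emb] by (simp add: U_def emb_zero)
      show "\<phi> + \<psi> \<in> U" if "\<phi> \<in> U" "\<psi> \<in> U" for \<phi> \<psi>
        using that W(1,3) emb_add by (smt (verit) U_def image_iff subsetD)
      show "fun_scale a \<phi> \<in> U" if "\<phi> \<in> U" for a \<phi>
        using that W(1,4) emb_smult by (smt (verit) U_def image_iff subsetD)
    qed
    have A_emb: "A g (emb v) = emb (\<rho> g *\<^sub>v v)" if "v \<in> carrier_vec n" for g v
      using that by (auto simp: A_def emb_def \<rho>_def scalar_prod_def fun_eq_iff lessThan_atLeast0)
    have A_U: "A g \<phi> \<in> U" if "g \<in> carrier G" "\<phi> \<in> U" for g \<phi>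
      using that W(1,5) A_emb by (auto simp: U_def)
    have A_V: "A g \<phi> \<in> V" for g \<phi> by (simp add: A_def V_def)
    have lin: "Vector_Spaces.linear fun_scale fun_scale (A g)" for g
      by unfold_locales (auto simp: A_def fun_eq_iff algebra_simps sum.distrib sum_distrib_left)
    have one: "A \<one>\<^bsub>G\<^esub> \<phi> = \<phi>" if "\<phi> \<in> V" for \<phi>
    proof
      fix i
      have "(\<Sum>j<n. c \<one>\<^bsub>G\<^esub> i j * \<phi> j) = (\<Sum>j<n. if j = i then \<phi> i else 0)" if "i < n"
        using less.prems that by (intro sum.cong) (auto simp: indexed_representation_def)
      then show "A \<one>\<^bsub>G\<^esub> \<phi> i = \<phi> i" using that by (auto simp: A_def V_def)
    qed
    have mult: "A (g \<otimes>\<^bsub>G\<^esub> h) \<phi> = A g (A h \<phi>)" if "g \<in> carrier G" "h \<in> carrier G" for g h \<phi>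
    proof
      fix i
      have "(\<Sum>j<n. c (g \<otimes>\<^bsub>G\<^esub> h) i j * \<phi> j) = (\<Sum>k<n. c g i k * (\<Sum>j<n. c h k j * \<phi> j))" if "i < n"
      proof -
        have "(\<Sum>j<n. c (g \<otimes>\<^bsub>G\<^esub> h) i j * \<phi> j) = (\<Sum>j<n. \<Sum>k<n. c g i k * c h k j * \<phi> j)"
          using less.prems that \<open>g \<in> carrier G\<close> \<open>h \<in> carrier G\<close>
          by (intro sum.cong) (auto simp: indexed_representation_def sum_distrib_right)
        also have "\<dots> = (\<Sum>k<n. \<Sum>j<n. c g i k * c h k j * \<phi> j)" by (rule sum.swap)
        finally show ?thesis by (simp add: sum_distrib_left mult.assoc)
      qed
      then show "A (g \<otimes>\<^bsub>G\<^esub> h) \<phi> i = A g (A h \<phi>) i" by (simp add: A_def)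
    qed
    obtain C where C: "C \<subseteq> U" "fv.independent C" "U \<subseteq> fv.span C"
      using fv.maximal_independent_subset[of U] by blast
    have spC: "fv.span C = U" using C subU by (intro fv.span_subspace)
    obtain B where B: "C \<subseteq> B" "B \<subseteq> V" "fv.independent B" "V \<subseteq> fv.span B"
      using fv.maximal_independent_subset_extend[of C V] C UV by blast
    have spB: "fv.span B = V" using B subV by (intro fv.span_subspace)
    have "finite B \<and> card B \<le> card (e ` {..<n})"
      using B V by (intro fv.independent_span_bound) auto
    then have finB: "finite B" and cardB: "card B \<le> n" by (auto simp: card_image[OF inj_e])
    have finC: "finite C" using B(1) finB finite_subset by blast
    \<comment> \<open>As \<open>W\<close> is proper and nonzero, both \<open>C\<close> and
      \<open>B - C\<close> have fewer than \<open>n\<close> elements, so the induction hypothesis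
      covers either block.\<close>
    have "C \<noteq> B"
    proof
      assume "C = B"
      then have "emb ` W = emb ` carrier_vec n" using spB spC emb_V by (simp add: U_def)
      then show False using inj_on_image_eq_iff[OF inj_emb W(1) order_refl] W(7) by simp
    qed
    then have "card C < n" using B(1) finB cardB psubset_card_mono[of B C] by (simp add: psubset_eq)
    have "C \<noteq> {}"
    proof
      assume "C = {}"
      then have "emb ` W = emb ` {0\<^sub>v n}" using spC emb_zero by (simp add: U_def)
      then show False using inj_on_image_eq_iff[OF inj_emb W(1), of "{0\<^sub>v n}"] W(6) by simp
    qed
    then have "card (B - C) < n"
      using B(1) finC cardB card_gt_0_iff[of C] \<open>card C < n\<close> card_Diff_subset[OF finC B(1)] by linarith
    \<comment> \<open>Two weights encode the flag \<open>U \<subseteq> V\<close>: 0 for the basis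
      vectors of \<open>U\<close>, 1 for the remaining ones.\<close>
    define w where "w b = (if b \<in> C then 0 else 1 :: nat)" for b
    define d where "d g b' b = fv.representation B (A g b) b'" for g b' b
    have tri: "A g b \<in> fv.span {b' \<in> B. w b' \<le> w b}" if "g \<in> carrier G" "b \<in> B" for g b
    proof (cases "b \<in> C")
      case True
      then have "{b' \<in> B. w b' \<le> w b} = C" using B(1) by (auto simp: w_def)
      then show ?thesis using A_U[OF that(1)] True C(1) spC by auto
    next
      case False
      then have "{b' \<in> B. w b' \<le> w b} = B" by (auto simp: w_def)
      then show ?thesis using A_V spB by simp
    qed
    have block: "indexed_representation G {b \<in> B. w b = t} d" for t
      unfolding d_def
      by (rule fv.block_indexed_representation[OF is_monoid finB B(3) lin tri])
         (use B(2) one mult in auto)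
    have eff: "effective_character G (\<lambda>g. \<Sum>b\<in>D. d g b b)"
      if "indexed_representation G D d" "card D < n" for D
    proof -
      have "finite D" using that by (simp add: indexed_representation_def)
      then obtain f where f: "bij_betw f {..<card D} D"
        using ex_bij_betw_nat_finite[of D] by (auto simp: lessThan_atLeast0)
      have "(\<Sum>b\<in>D. d g b b) = (\<Sum>i<card D. d g (f i) (f i))" for g
        by (rule sum.reindex_bij_betw[OF f, symmetric])
      then show ?thesis
        using less.IH[OF that(2) indexed_representation_reindex[OF that(1) f]] by simp
    qed
    have "{b \<in> B. w b = 0} = C" "{b \<in> B. w b = 1} = B - C" using B(1) by (auto simp: w_def)
    then have "effective_character G (\<lambda>g. (\<Sum>b\<in>C. d g b b) + (\<Sum>b\<in>B - C. d g b b))"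
      using block[of 0] block[of 1] \<open>card C < n\<close> \<open>card (B - C) < n\<close>
      by (intro effective_character_add eff) auto
    \<comment> \<open>The original trace is that of \<open>A g\<close> in the basis of unit vectors;
      it is moved to \<open>B\<close> and then split into the two blocks.\<close>
    moreover have "(\<Sum>i<n. c g i i) = (\<Sum>b\<in>C. d g b b) + (\<Sum>b\<in>B - C. d g b b)" for g
    proof -
      have ind_e: "fv.independent (e ` {..<n})"
      proof (rule fv.independent_if_scalars_zero)
        fix r \<phi> assume z: "(\<Sum>\<phi>\<in>e ` {..<n}. fun_scale (r \<phi>) \<phi>) = 0" and "\<phi> \<in> e ` {..<n}"
        then obtain i where i: "i < n" "\<phi> = e i" by auto
        have "0 = (\<Sum>\<phi>\<in>e ` {..<n}. fun_scale (r \<phi>) \<phi>) i" using z by simp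
        also have "\<dots> = (\<Sum>j<n. r (e j) * e j i)"
          by (simp add: sum.reindex[OF inj_e] sum_fun_apply)
        also have "\<dots> = (\<Sum>j<n. if j = i then r (e i) else 0)" by (intro sum.cong) (auto simp: e_def)
        finally show "r \<phi> = 0" using i by simp
      qed simp
      have "fv.representation (e ` {..<n}) (A g (e i)) (e i) = c g i i" if i: "i < n" for i
      proof -
        let ?r = "fv.representation (e ` {..<n}) (A g (e i))"
        have "A g (e i) = (\<Sum>\<phi>\<in>e ` {..<n}. fun_scale (?r \<phi>) \<phi>)"
          using fv.sum_representation_eq[OF ind_e] A_V V by simp
        then have "A g (e i) i = (\<Sum>\<phi>\<in>e ` {..<n}. fun_scale (?r \<phi>) \<phi>) i" by (rule fun_cong)
        also have "\<dots> = (\<Sum>j<n. ?r (e j) * e j i)"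
          by (simp add: sum.reindex[OF inj_e] sum_fun_apply)
        also have "\<dots> = (\<Sum>j<n. if j = i then ?r (e i) else 0)" by (intro sum.cong) (auto simp: e_def)
        finally have "?r (e i) = A g (e i) i" using i by simp
        also have "\<dots> = (\<Sum>j<n. c g i j * e i j)" using i by (simp add: A_def)
        also have "\<dots> = (\<Sum>j<n. if j = i then c g i i else 0)" by (intro sum.cong) (auto simp: e_def)
        finally show ?thesis using i by simp
      qed
      then have "(\<Sum>i<n. c g i i) = (\<Sum>\<phi>\<in>e ` {..<n}. fv.representation (e ` {..<n}) (A g \<phi>) \<phi>)"
        by (simp add: sum.reindex[OF inj_e])
      also have "\<dots> = (\<Sum>b\<in>B. d g b b)"
        unfolding d_def using V spB A_V ind_e B(3) finB lin
        by (intro fv.trace_basis_independent) auto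
      also have "\<dots> = (\<Sum>b\<in>C. d g b b) + (\<Sum>b\<in>B - C. d g b b)"
        using sum.subset_diff[OF B(1) finB] by (simp add: add.commute)
      finally show ?thesis .
    qed
    ultimately show ?thesis by simp
  qed
qed

lemma effective_character_trace:
  fixes c :: "'g \<Rightarrow> 'j \<Rightarrow> 'j \<Rightarrow> complex"
  assumes "group G" "indexed_representation G J c"
  shows "effective_character G (\<lambda>g. \<Sum>j\<in>J. c g j j)"
proof -
  have "finite J" using assms by (simp add: indexed_representation_def)
  then obtain f where f: "bij_betw f {..<card J} J"
    using ex_bij_betw_nat_finite[of J] by (auto simp: lessThan_atLeast0)
  have "(\<Sum>j\<in>J. c g j j) = (\<Sum>i<card J. c g (f i) (f i))" for g
    by (rule sum.reindex_bij_betw[OF f, symmetric])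
  then show ?thesis
    using effective_character_trace_lessThan[OF assms(1) indexed_representation_reindex[OF assms(2) f]] by simp
qed

section \<open>Linear extensions and cuts\<close>

text \<open>A linear extension by lexicographic coding: the size of the down-set grows strictly
  along \<open>r\<close>, and the enumeration \<open>e\<close>, being smaller than
  \<open>card A\<close>, breaks ties.\<close>

lemma partial_order_on_rank:
  assumes "finite A" "partial_order_on A r"
  obtains h :: "'a \<Rightarrow> nat" where "inj_on h A" "\<And>x y. (x, y) \<in> r \<Longrightarrow> h x \<le> h y"
proof -
  have r: "r \<subseteq> A \<times> A" "trans r" "antisym r" "refl_on A r"
    using assms(2) by (auto simp: partial_order_on_def preorder_on_def)
  define down where "down y = {x. (x, y) \<in> r}" for y
  have fin: "finite (down y)" for y
    using r(1) assms(1) by (intro finite_subset[of "down y" A]) (auto simp: down_def)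
  have down: "card (down x) < card (down y)" if "(x, y) \<in> r" "x \<noteq> y" for x y
  proof (rule psubset_card_mono[OF fin])
    have "down x \<subseteq> down y" using that transD[OF r(2)] by (auto simp: down_def)
    moreover have "y \<in> down y" using r that by (auto simp: down_def refl_on_def)
    moreover have "y \<notin> down x" using antisymD[OF r(3)] that by (auto simp: down_def)
    ultimately show "down x \<subset> down y" by auto
  qed
  obtain e where e: "bij_betw e A {0..<card A}" using ex_bij_betw_finite_nat[OF assms(1)] by blast
  have eA: "e x < card A" if "x \<in> A" for x using e that by (auto simp: bij_betw_def)
  define h where "h x = card (down x) * card A + e x" for x
  show thesis
  proof
    show "inj_on h A"
    proof (rule inj_onI)
      fix x y assume xy: "x \<in> A" "y \<in> A" "h x = h y"
      then have "h x mod card A = h y mod card A" by simp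
      then have "e x = e y" using eA[OF xy(1)] eA[OF xy(2)] by (simp add: h_def)
      then show "x = y" using e xy by (auto simp: bij_betw_def inj_on_def)
    qed
    show "h x \<le> h y" if "(x, y) \<in> r" for x y
    proof (cases "x = y")
      case False
      then have "Suc (card (down x)) * card A \<le> card (down y) * card A"
        using down[OF that] by (intro mult_le_mono1) auto
      moreover have "e x < card A" using eA r(1) that by auto
      ultimately show ?thesis by (simp add: h_def)
    qed simp
  qed
qed

lemma card_le_of_bij_betw:
  assumes "bij_betw f A {1..n}" "p \<le> n"
  shows "card {x \<in> A. f x \<le> p} = p"
proof -
  have "bij_betw f {x \<in> A. f x \<le> p} {1..p}"
    using assms by (auto simp: bij_betw_def inj_on_def image_iff) (metis atLeastAtMost_iff imageE le_trans)
  then show ?thesis using bij_betw_same_card by fastforce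
qed

text \<open>The linear extension \<omega> of \<open>le2\<close> is fixed once, since descents and
  inversions are taken with respect to it. Automorphisms need not preserve \<omega>.\<close>

locale special_double_poset =
  fixes N :: "'a set" and le1 le2 :: "'a rel" and \<omega> :: "'a \<Rightarrow> nat"
  assumes finite_N: "finite N" and po1: "partial_order_on N le1" and po2: "partial_order_on N le2"
    and special: "locally_special N le1 le2"
    and inj_\<omega>: "inj_on \<omega> N" and mono_\<omega>: "(x, y) \<in> le2 \<Longrightarrow> \<omega> x \<le> \<omega> y"
begin

text \<open>The value \<open>l x\<close> is the position of \<open>x\<close>, counted from 1.
  Extensionality makes the set finite and lets equality be checked on \<open>N\<close>.\<close>

definition linexts :: "('a \<Rightarrow> nat) set" where
  "linexts = {l \<in> extensional N. bij_betw l N {1..card N} \<and>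
     (\<forall>x\<in>N. \<forall>y\<in>N. (x, y) \<in> le1 \<longrightarrow> l x \<le> l y)}"

definition cut_class :: "nat set \<Rightarrow> ('a \<Rightarrow> nat) \<Rightarrow> ('a \<Rightarrow> nat) set" where
  "cut_class S l = {k \<in> linexts. \<forall>t\<in>S. \<forall>x\<in>N. k x \<le> t \<longleftrightarrow> l x \<le> t}"

text \<open>This is the strictness demanded of a \<open>D\<close>-partition, read off a linear
  extension whose positions are grouped by the cuts in \<open>S\<close>.\<close>

definition separates :: "nat set \<Rightarrow> ('a \<Rightarrow> nat) \<Rightarrow> bool" where
  "separates S l \<longleftrightarrow> (\<forall>i\<in>N. \<forall>j\<in>N. (i, j) \<in> le1 - Id \<and> (j, i) \<in> le2 - Id \<longrightarrow>
     (\<exists>t\<in>S. l i \<le> t \<and> t < l j))"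

definition cut_classes :: "nat set \<Rightarrow> ('a \<Rightarrow> nat) set set" where
  "cut_classes S = cut_class S ` {l \<in> linexts. separates S l}"

text \<open>The number \<open>t\<close> names the gap between positions \<open>t\<close> and
  \<open>t + 1\<close>, in agreement with the cuts \<open>l x \<le> t\<close>.\<close>

definition descents :: "('a \<Rightarrow> nat) \<Rightarrow> nat set" where
  "descents l = {t. \<exists>x\<in>N. \<exists>y\<in>N. l x = t \<and> l y = Suc t \<and> \<omega> y < \<omega> x}"

definition inversions :: "('a \<Rightarrow> nat) \<Rightarrow> ('a \<times> 'a) set" where
  "inversions l = {(x, y). x \<in> N \<and> y \<in> N \<and> \<omega> x < \<omega> y \<and> l y < l x}"

lemma linextsD:
  assumes "l \<in> linexts"
  shows "l \<in> extensional N" "bij_betw l N {1..card N}" "inj_on l N"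
    "x \<in> N \<Longrightarrow> 1 \<le> l x" "x \<in> N \<Longrightarrow> l x \<le> card N"
    "x \<in> N \<Longrightarrow> y \<in> N \<Longrightarrow> l x = l y \<longleftrightarrow> x = y"
    "x \<in> N \<Longrightarrow> y \<in> N \<Longrightarrow> (x, y) \<in> le1 \<Longrightarrow> l x \<le> l y"
proof -
  show *: "l \<in> extensional N" "bij_betw l N {1..card N}" "inj_on l N"
    using assms by (auto simp: linexts_def bij_betw_def)
  show "1 \<le> l x" "l x \<le> card N" if "x \<in> N" using bij_betwE[OF *(2)] that by auto
  show "l x = l y \<longleftrightarrow> x = y" if "x \<in> N" "y \<in> N" using *(3) that by (auto simp: inj_on_def)
  show "l x \<le> l y" if "x \<in> N" "y \<in> N" "(x, y) \<in> le1" using assms that by (auto simp: linexts_def)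
qed

lemma linexts_obtain:
  assumes "l \<in> linexts" "1 \<le> p" "p \<le> card N"
  obtains x where "x \<in> N" "l x = p"
proof -
  have "p \<in> l ` N" using linextsD(2)[OF assms(1)] assms by (simp add: bij_betw_def)
  then show thesis using that by auto
qed

lemma finite_linexts: "finite linexts"
proof (rule finite_subset)
  show "linexts \<subseteq> N \<rightarrow>\<^sub>E {1..card N}" by (auto simp: linexts_def PiE_def dest: bij_betwE)
  show "finite (N \<rightarrow>\<^sub>E {1..card N})" by (intro finite_PiE finite_N) simp
qed

lemma finite_inversions: "finite (inversions l)"
  by (rule finite_subset[of _ "N \<times> N"]) (auto simp: inversions_def finite_N)

lemma descents_subset: "l \<in> linexts \<Longrightarrow> descents l \<subseteq> {1..<card N}"
  by (force simp: descents_def dest: linextsD(4,5))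

text \<open>Walking from position \<open>l x\<close> to position \<open>l y\<close>, \<omega> rises
  at every gap that is not a descent. Its contrapositive is what gets used: a fall of \<omega>
  forces a descent in between.\<close>

lemma ascending_without_descent:
  assumes l: "l \<in> linexts" and x: "x \<in> N"
    and no: "\<And>t. t \<in> descents l \<Longrightarrow> l x \<le> t \<Longrightarrow> t < l y \<Longrightarrow> False"
    and y: "y \<in> N" "l x \<le> l y"
  shows "\<omega> x \<le> \<omega> y"
proof -
  have "\<forall>z\<in>N. l z = p \<longrightarrow> \<omega> x \<le> \<omega> z" if "l x \<le> p" "p \<le> l y" for p
    using that
  proof (induction p rule: dec_induct)
    case base
    then show ?case using linextsD(6)[OF l] x by auto
  next
    case (step p)
    show ?case
    proof (intro ballI impI)
      fix z assume z: "z \<in> N" "l z = Suc p"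
      have "1 \<le> p" using step(1) linextsD(4)[OF l x] by simp
      moreover have "p \<le> card N" using linextsD(5)[OF l y(1)] step by simp
      ultimately obtain u where u: "u \<in> N" "l u = p" by (rule linexts_obtain[OF l])
      have "\<omega> x \<le> \<omega> u" using step u by simp
      moreover have "p \<notin> descents l" using no[of p] step by auto
      then have "\<omega> u \<le> \<omega> z" using u z by (force simp: descents_def)
      ultimately show "\<omega> x \<le> \<omega> z" by simp
    qed
  qed
  then show ?thesis using y by auto
qed

lemma \<omega>_less: "x \<in> N \<Longrightarrow> y \<in> N \<Longrightarrow> (x, y) \<in> le2 - Id \<Longrightarrow> \<omega> x < \<omega> y"
  using mono_\<omega> inj_\<omega> by (fastforce simp: inj_on_def le_less)

text \<open>Across a strict relation \<omega> falls while the position grows, so a descent lies in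
  between. Hence the class of \<open>l\<close> for its own descent set belongs to
  \<open>cut_classes\<close>.\<close>

lemma separates_descents:
  assumes "l \<in> linexts"
  shows "separates (descents l) l"
  unfolding separates_def
proof (intro ballI impI)
  fix i j assume ij: "i \<in> N" "j \<in> N" "(i, j) \<in> le1 - Id \<and> (j, i) \<in> le2 - Id"
  then have "\<not> \<omega> i \<le> \<omega> j" using \<omega>_less by fastforce
  moreover have "l i \<le> l j" using linextsD(7)[OF assms] ij by auto
  ultimately show "\<exists>t\<in>descents l. l i \<le> t \<and> t < l j"
    using ascending_without_descent[OF assms ij(1) _ ij(2)] by blast
qed

text \<open>An inversion of \<open>l\<close> straddles a descent, and the cut at that descent keeps
  the two elements in the same order throughout the class.\<close>

lemma inversions_mono:
  assumes "l \<in> linexts" "k \<in> cut_class (descents l) l"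
  shows "inversions l \<subseteq> inversions k"
proof clarify
  fix x y assume "(x, y) \<in> inversions l"
  then have xy: "x \<in> N" "y \<in> N" "\<omega> x < \<omega> y" "l y < l x" by (auto simp: inversions_def)
  then obtain t where t: "t \<in> descents l" "l y \<le> t" "t < l x"
    using ascending_without_descent[OF assms(1) xy(2) _ xy(1)] by fastforce
  then have "k y \<le> t" "\<not> k x \<le> t" using assms(2) xy by (auto simp: cut_class_def)
  then show "(x, y) \<in> inversions k" using xy by (simp add: inversions_def)
qed

text \<open>Given \<omega>, the inversions determine the order of every pair, and the position of an
  element is the number of elements up to it.\<close>

lemma inversions_inj:
  assumes "l \<in> linexts" "k \<in> linexts" "inversions l = inversions k"
  shows "l = k"
proof (rule extensionalityI[of _ N])
  fix x assume x: "x \<in> N"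
  have "l y \<le> l x \<longleftrightarrow> k y \<le> k x" if y: "y \<in> N" for y
  proof (cases "x = y")
    case False
    have "(x, y) \<in> inversions l \<longleftrightarrow> (x, y) \<in> inversions k"
      "(y, x) \<in> inversions l \<longleftrightarrow> (y, x) \<in> inversions k" using assms(3) by auto
    moreover have "\<omega> x \<noteq> \<omega> y" using inj_\<omega> x y False by (auto simp: inj_on_def)
    moreover have "l x \<noteq> l y" "k x \<noteq> k y" using linextsD(6) assms x y False by auto
    ultimately show ?thesis using x y by (auto simp: inversions_def)
  qed simp
  then have "{y \<in> N. l y \<le> l x} = {y \<in> N. k y \<le> k x}" by auto
  moreover have "card {y \<in> N. l y \<le> l x} = l x" "card {y \<in> N. k y \<le> k x} = k x"
    using linextsD(2,5) assms x card_le_of_bij_betw by metis+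
  ultimately show "l x = k x" by metis
qed (use assms linextsD in auto)

lemma cut_class_self: "l \<in> linexts \<Longrightarrow> l \<in> cut_class S l"
  by (simp add: cut_class_def)

lemma cut_class_eq: "k \<in> cut_class S l \<Longrightarrow> cut_class S k = cut_class S l"
  by (auto simp: cut_class_def)

lemma separates_cut_class: "k \<in> cut_class S l \<Longrightarrow> separates S k \<longleftrightarrow> separates S l"
  unfolding separates_def cut_class_def by (simp add: not_le[symmetric])

text \<open>The elements at positions \<open>t\<close> and \<open>t + 1\<close> are exchanged, which
  removes exactly one inversion. Local speciality guarantees that the result is still a linear
  extension.\<close>

lemma descent_swap:
  assumes l: "l \<in> linexts" and t: "t \<in> descents l" "t \<notin> S" and sep: "separates S l"
  obtains k where "k \<in> cut_class S l" "inversions k \<subset> inversions l"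
proof -
  obtain x y where xy: "x \<in> N" "y \<in> N" "l x = t" "l y = Suc t" "\<omega> y < \<omega> x"
    using t by (auto simp: descents_def)
  have ne: "x \<noteq> y" using xy by auto
  have other: "l z \<noteq> t" "l z \<noteq> Suc t" if "z \<in> N" "z \<noteq> x" "z \<noteq> y" for z
    using linextsD(6)[OF l] xy that by metis+
  \<comment> \<open>Elements in adjacent positions that are related by \<open>le1\<close> form a
    cover, hence are comparable in \<open>le2\<close>. The fall of \<omega> leaves only
    \<open>y\<close> below \<open>x\<close> there, and then \<open>separates\<close> would demand a
    cut at \<open>t\<close> itself.\<close>
  have inc: "(x, y) \<notin> le1"
  proof
    assume le: "(x, y) \<in> le1"
    have "covers le1 y x"
      unfolding covers_def
    proof (intro conjI notI)
      show "(x, y) \<in> le1 - Id" using le ne by simp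
      assume "\<exists>z. (x, z) \<in> le1 - Id \<and> (z, y) \<in> le1 - Id"
      then obtain z where z: "(x, z) \<in> le1" "(z, y) \<in> le1" "z \<noteq> x" "z \<noteq> y" by auto
      then have "z \<in> N" using po1 by (auto simp: partial_order_on_def preorder_on_def)
      then have "t \<le> l z" "l z \<le> Suc t" using linextsD(7)[OF l] z xy by metis+
      then show False using other[OF \<open>z \<in> N\<close>] z by linarith
    qed
    then have "(x, y) \<in> le2 \<or> (y, x) \<in> le2" using special xy by (simp add: locally_special_def)
    then have "(y, x) \<in> le2" using mono_\<omega>[of x y] xy by auto
    then have "\<exists>s\<in>S. l x \<le> s \<and> s < l y"
      using sep le ne xy(1,2) unfolding separates_def by blast
    then have "t \<in> S" using xy by (metis le_antisym less_Suc_eq_le)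
    then show False using t by simp
  qed
  define k where "k = l(x := Suc t, y := t)"
  have kx: "k x = Suc t" "k y = t" using ne by (auto simp: k_def)
  have kz: "k z = l z" if "z \<noteq> x" "z \<noteq> y" for z using that by (simp add: k_def)
  \<comment> \<open>The exchange alters the initial segment of size \<open>t\<close> alone, so the
    cuts in \<open>S\<close> survive.\<close>
  have cut: "k z \<le> s \<longleftrightarrow> l z \<le> s" if "s \<noteq> t" for z s
    using that kx kz[of z] xy by (cases "z = x"; cases "z = y") auto
  \<comment> \<open>The pair \<open>(x, y)\<close> is the only one whose order is reversed, and
    \<open>inc\<close> keeps it out of \<open>le1\<close>.\<close>
  have order: "k z \<le> k w" if "z \<in> N" "w \<in> N" "l z \<le> l w" "(z, w) \<noteq> (x, y)" for z w
    using that kx kz[of z] kz[of w] xy other[of z] other[of w]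
    by (cases "z = x"; cases "z = y"; cases "w = x"; cases "w = y") auto
  have "bij_betw k N {1..card N}"
  proof -
    have "k z = (l \<circ> transpose x y) z" for z
      using ne xy by (auto simp: k_def transpose_def)
    then have "k = l \<circ> transpose x y" by blast
    then show ?thesis
      using linextsD(2)[OF l] xy bij_betw_trans[OF bij_betw_transpose_iff[of x N y]] by simp
  qed
  moreover have "k \<in> extensional N"
    using linextsD(1)[OF l] xy by (auto simp: k_def extensional_def)
  ultimately have k: "k \<in> linexts"
    using order inc linextsD(7)[OF l] by (auto simp: linexts_def)
  have "inversions k \<subseteq> inversions l"
  proof clarify
    fix a b assume ab: "(a, b) \<in> inversions k"
    then have "a \<in> N" "b \<in> N" "\<not> k a \<le> k b" "(a, b) \<noteq> (x, y)" using xy by (auto simp: inversions_def)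
    then have "\<not> l a \<le> l b" using order by blast
    then show "(a, b) \<in> inversions l" using ab by (simp add: inversions_def)
  qed
  moreover have "(y, x) \<in> inversions l" "(y, x) \<notin> inversions k" using xy kx by (auto simp: inversions_def)
  moreover have "k z \<le> s \<longleftrightarrow> l z \<le> s" if "s \<in> S" for z s using cut t(2) that by metis
  then have "k \<in> cut_class S l" using k by (simp add: cut_class_def)
  ultimately show thesis using that by blast
qed

text \<open>Descents outside \<open>S\<close> are swapped away one at a time within the class; the
  shrinking set of inversions makes this terminate.\<close>

lemma ex_descents_subset:
  assumes "l \<in> linexts" "separates S l"
  obtains k where "k \<in> cut_class S l" "descents k \<subseteq> S"
proof -
  have "\<exists>k\<in>cut_class S l. descents k \<subseteq> S"
    using assms
  proof (induction "card (inversions l)" arbitrary: l rule: less_induct)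
    case less
    show ?case
    proof (cases "descents l \<subseteq> S")
      case True
      then show ?thesis using cut_class_self less.prems by blast
    next
      case False
      then obtain t where "t \<in> descents l" "t \<notin> S" by blast
      from descent_swap[OF less.prems(1) this less.prems(2)] obtain k
        where k: "k \<in> cut_class S l" "inversions k \<subset> inversions l" by blast
      have "\<exists>k'\<in>cut_class S k. descents k' \<subseteq> S"
      proof (rule less.hyps)
        show "card (inversions k) < card (inversions l)"
          by (rule psubset_card_mono[OF finite_inversions k(2)])
      qed (use k separates_cut_class[OF k(1)] less.prems in \<open>auto simp: cut_class_def\<close>)
      then show ?thesis using cut_class_eq[OF k(1)] by simp
    qed
  qed
  then show thesis using that by blast
qed

end

section \<open>The representation on functions of linear extensions\<close>

text \<open>Extending \<open>B\<close> to a basis of the span of \<open>E\<close> adds nothing,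
  because such a basis has at most \<open>card E\<close> elements.\<close>

lemma (in vector_space) span_eq_if_card_le:
  assumes "independent B" "B \<subseteq> span E" "finite E" "card E \<le> card B"
  shows "span B = span E"
proof -
  obtain B' where B': "B \<subseteq> B'" "B' \<subseteq> span E" "independent B'" "span E \<subseteq> span B'"
    using maximal_independent_subset_extend[OF assms(2,1)] by blast
  have "finite B' \<and> card B' \<le> card E" by (rule independent_span_bound[OF assms(3) B'(3,2)])
  then have "B = B'" using B'(1) assms(4) by (intro card_seteq) auto
  then show ?thesis using B' by (metis span_span span_mono subset_antisym)
qed

text \<open>The diagonal entry is 1 at a fixed basis vector and 0 at any other, as for a permutation
  character.\<close>

lemma (in vector_space) trace_permuted_basis:
  assumes "finite E" "independent E" "\<And>e. e \<in> E \<Longrightarrow> T e \<in> E"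
  shows "(\<Sum>e\<in>E. representation E (T e) e) = of_nat (card {e \<in> E. T e = e})"
proof -
  have "(\<Sum>e\<in>E. representation E (T e) e) = (\<Sum>e\<in>E. if T e = e then 1 else 0)"
    using assms by (intro sum.cong) (auto simp: representation_basis)
  also have "\<dots> = of_nat (card {e \<in> E. T e = e})"
    using assms(1) by (simp flip: sum.inter_filter)
  finally show ?thesis .
qed

lemma inj_indicator: "inj (indicator :: 'x set \<Rightarrow> 'x \<Rightarrow> 'k::zero_neq_one)"
proof (rule injI)
  fix A B :: "'x set" assume "(indicator A :: 'x \<Rightarrow> 'k) = indicator B"
  then have "(indicator A x = (1::'k)) = (indicator B x = (1::'k))" for x by simp
  then show "A = B" by (auto simp: indicator_eq_1_iff)
qed

context special_double_poset
begin

text \<open>Acting by composition inside the argument gives a left action: both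
  \<open>g \<otimes> h\<close> and \<open>g\<close> after \<open>h\<close> evaluate at
  \<open>k\<close> followed after \<open>g\<close> and \<open>h\<close>. The value 0 off
  \<open>linexts\<close> matches the support of the class indicators.\<close>

definition pullback :: "('a \<Rightarrow> 'a) \<Rightarrow> (('a \<Rightarrow> nat) \<Rightarrow> complex) \<Rightarrow> ('a \<Rightarrow> nat) \<Rightarrow> complex" where
  "pullback g \<phi> = (\<lambda>k. if k \<in> linexts then \<phi> (compose N k g) else 0)"

text \<open>A preimage under composition with \<open>g\<close>, hence for an automorphism the image
  under composition with its inverse; chosen so that \<open>pullback\<close> maps indicators to
  indicators.\<close>

definition class_image :: "('a \<Rightarrow> 'a) \<Rightarrow> ('a \<Rightarrow> nat) set \<Rightarrow> ('a \<Rightarrow> nat) set" where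
  "class_image g C = {k \<in> linexts. compose N k g \<in> C}"

definition class_vectors :: "nat set \<Rightarrow> (('a \<Rightarrow> nat) \<Rightarrow> complex) set" where
  "class_vectors S = indicator ` cut_classes S"

definition descent_vector :: "('a \<Rightarrow> nat) \<Rightarrow> ('a \<Rightarrow> nat) \<Rightarrow> complex" where
  "descent_vector l = indicator (cut_class (descents l) l)"

section \<open>Automorphisms acting on cut classes\<close>

lemma autoD:
  assumes "g \<in> dposet_auto N le1 le2"
  shows "bij_betw g N N" "x \<in> N \<Longrightarrow> g x \<in> N"
    "x \<in> N \<Longrightarrow> y \<in> N \<Longrightarrow> (g x, g y) \<in> le1 \<longleftrightarrow> (x, y) \<in> le1"
    "x \<in> N \<Longrightarrow> y \<in> N \<Longrightarrow> (g x, g y) \<in> le2 \<longleftrightarrow> (x, y) \<in> le2"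
    "x \<in> N \<Longrightarrow> y \<in> N \<Longrightarrow> g x = g y \<longleftrightarrow> x = y"
proof -
  show bij: "bij_betw g N N" using assms by (auto simp: dposet_auto_def Bij_def)
  show "g x \<in> N" if "x \<in> N" using bij that by (auto simp: bij_betw_def)
  show "g x = g y \<longleftrightarrow> x = y" if "x \<in> N" "y \<in> N" using bij that by (auto simp: bij_betw_def inj_on_def)
qed (use assms in \<open>auto simp: dposet_auto_def\<close>)

lemma auto_obtain:
  assumes "g \<in> dposet_auto N le1 le2" "y \<in> N"
  obtains x where "x \<in> N" "g x = y"
  using autoD(1)[OF assms(1)] assms(2) that by (metis bij_betw_imp_surj_on imageE)

lemma compose_linexts:
  assumes g: "g \<in> dposet_auto N le1 le2" and "k \<in> linexts"
  shows "compose N k g \<in> linexts"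
proof -
  have "bij_betw (compose N k g) N {1..card N}"
    using bij_betw_trans[OF autoD(1)[OF g] linextsD(2)[OF assms(2)]]
    by (subst bij_betw_cong[of N _ "k \<circ> g"]) (auto simp: compose_def)
  then show ?thesis
    using assms(2) autoD(2,3)[OF g] by (auto simp: linexts_def compose_eq)
qed

lemma pullback_indicator: "pullback g (indicator C) = indicator (class_image g C)"
  by (auto simp: pullback_def class_image_def indicator_def fun_eq_iff)

text \<open>The new class is represented by \<open>l'\<close>, which is \<open>l\<close> composed
  with the inverse \<open>h\<close> of \<open>g\<close>. Cuts are compared at the points
  \<open>g x\<close>, which exhaust \<open>N\<close>, and separation survives because
  \<open>g\<close> preserves both orders.\<close>

lemma class_image_cut_classes:
  assumes g: "g \<in> dposet_auto N le1 le2" and "C \<in> cut_classes S"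
  shows "class_image g C \<in> cut_classes S"
proof -
  obtain l where l: "l \<in> linexts" "separates S l" "C = cut_class S l"
    using assms by (auto simp: cut_classes_def)
  define h where "h = (\<lambda>x\<in>N. inv_into N g x)"
  have "inv\<^bsub>BijGroup N\<^esub> g \<in> dposet_auto N le1 le2"
    by (rule subgroup.m_inv_closed[OF subgroup_dposet_auto g])
  then have h: "h \<in> dposet_auto N le1 le2"
    using g by (simp add: h_def inv_BijGroup dposet_auto_def)
  have hg: "h (g x) = x" if "x \<in> N" for x
    using autoD(1,2)[OF g] that by (simp add: h_def bij_betw_inv_into_left)
  define l' where "l' = compose N l h"
  have l': "l' \<in> linexts" using compose_linexts[OF h l(1)] by (simp add: l'_def)
  have l'g: "l' (g x) = l x" if "x \<in> N" for x
    using that autoD(2)[OF g] hg by (simp add: l'_def compose_eq)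
  have "class_image g C = cut_class S l'"
  proof -
    have "compose N k g \<in> cut_class S l \<longleftrightarrow> k \<in> cut_class S l'" if "k \<in> linexts" for k
    proof -
      have "compose N k g \<in> cut_class S l \<longleftrightarrow> (\<forall>t\<in>S. \<forall>x\<in>N. k (g x) \<le> t \<longleftrightarrow> l' (g x) \<le> t)"
        using compose_linexts[OF g that] l'g by (simp add: cut_class_def compose_eq)
      also have "\<dots> \<longleftrightarrow> k \<in> cut_class S l'"
        using that autoD(2)[OF g] auto_obtain[OF g] unfolding cut_class_def by (simp, metis)
      finally show ?thesis .
    qed
    moreover have "cut_class S l' \<subseteq> linexts" by (auto simp: cut_class_def)
    ultimately show ?thesis unfolding class_image_def l(3) by blast
  qed
  moreover have "separates S l'"
    unfolding separates_def
  proof (intro ballI impI)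
    fix i j assume ij: "i \<in> N" "j \<in> N" "(i, j) \<in> le1 - Id \<and> (j, i) \<in> le2 - Id"
    obtain i' where i': "i' \<in> N" "g i' = i" using auto_obtain[OF g ij(1)] .
    obtain j' where j': "j' \<in> N" "g j' = j" using auto_obtain[OF g ij(2)] .
    have "(i', j') \<in> le1 - Id \<and> (j', i') \<in> le2 - Id"
      using ij i' j' autoD(3,4)[OF g] by auto
    then have "\<exists>t\<in>S. l i' \<le> t \<and> t < l j'" using l(2) i' j' unfolding separates_def by blast
    then show "\<exists>t\<in>S. l' i \<le> t \<and> t < l' j" using i' j' l'g by metis
  qed
  ultimately show ?thesis using l' by (auto simp: cut_classes_def)
qed

section \<open>Indicator functions of cut classes and descent vectors\<close>

lemma finite_cut_classes: "finite (cut_classes S)"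
  by (simp add: cut_classes_def finite_linexts)

lemma cut_classesD:
  assumes "C \<in> cut_classes S" "k \<in> C"
  shows "k \<in> linexts" "separates S k" "C = cut_class S k"
proof -
  obtain l where l: "l \<in> linexts" "separates S l" "C = cut_class S l"
    using assms by (auto simp: cut_classes_def)
  then show "k \<in> linexts" "separates S k" "C = cut_class S k"
    using assms(2) separates_cut_class[of k S l] cut_class_eq[of k S l] by (auto simp: cut_class_def)
qed

lemma cut_class_in_cut_classes: "k \<in> linexts \<Longrightarrow> separates S k \<Longrightarrow> cut_class S k \<in> cut_classes S"
  by (auto simp: cut_classes_def)

lemma cut_class_mono: "S \<subseteq> S' \<Longrightarrow> cut_class S' l \<subseteq> cut_class S l"
  by (auto simp: cut_class_def)

lemma separates_mono: "S \<subseteq> S' \<Longrightarrow> separates S l \<Longrightarrow> separates S' l"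
  unfolding separates_def by blast

text \<open>A class for \<open>S\<close> is the disjoint union of the finer classes inside it, and
  these separate because more cuts are available.\<close>

lemma indicator_cut_class_span:
  assumes "C \<in> cut_classes S" "S \<subseteq> S'"
  shows "indicator C \<in> fv.span (class_vectors S')"
proof -
  define P where "P = {D \<in> cut_classes S'. D \<subseteq> C}"
  have fin: "finite P" by (simp add: P_def finite_cut_classes)
  have "(indicator C :: _ \<Rightarrow> complex) = (\<Sum>D\<in>P. indicator D)"
  proof
    fix k
    show "(indicator C k :: complex) = (\<Sum>D\<in>P. indicator D) k"
    proof (cases "k \<in> C")
      case True
      note k = cut_classesD[OF assms(1) True]
      have "cut_class S' k \<in> P"
        using k cut_class_mono[OF assms(2)] separates_mono[OF assms(2)]
        by (auto simp: P_def intro: cut_class_in_cut_classes)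
      moreover have "k \<in> D \<longleftrightarrow> D = cut_class S' k" if "D \<in> P" for D
        using that cut_classesD(3)[of D S' k] cut_class_self[OF k(1)] by (auto simp: P_def)
      then have "(\<Sum>D\<in>P. indicator D k :: complex) = (\<Sum>D\<in>P. if D = cut_class S' k then 1 else 0)"
        by (intro sum.cong) (auto simp: indicator_def)
      ultimately show ?thesis using True fin by (simp add: sum_fun_apply)
    next
      case False
      then have "(\<Sum>D\<in>P. indicator D k :: complex) = 0"
        by (intro sum.neutral) (auto simp: P_def indicator_def)
      then show ?thesis using False by (simp add: sum_fun_apply)
    qed
  qed
  also have "\<dots> \<in> fv.span (class_vectors S')"
    by (intro fv.span_sum fv.span_base) (auto simp: P_def class_vectors_def)
  finally show ?thesis .
qed

lemma finite_class_vectors: "finite (class_vectors S)"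
  by (simp add: class_vectors_def finite_cut_classes)

text \<open>Classes are nonempty and pairwise disjoint, so evaluation at a member of
  \<open>C\<close> isolates the coefficient of its indicator.\<close>

lemma independent_class_vectors: "fv.independent (class_vectors S)"
proof (rule fv.independent_if_scalars_zero[OF finite_class_vectors])
  fix r e
  assume z: "(\<Sum>e\<in>class_vectors S. fun_scale (r e) e) = 0" and "e \<in> class_vectors S"
  then obtain C where C: "C \<in> cut_classes S" "e = indicator C" by (auto simp: class_vectors_def)
  then obtain k where k: "k \<in> C" using cut_class_self by (auto simp: cut_classes_def)
  have "0 = (\<Sum>e\<in>class_vectors S. fun_scale (r e) e) k" using z by simp
  also have "\<dots> = (\<Sum>D\<in>cut_classes S. r (indicator D) * indicator D k)"
    by (simp add: class_vectors_def sum.reindex[OF inj_on_subset[OF inj_indicator]] sum_fun_apply)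
  also have "\<dots> = (\<Sum>D\<in>cut_classes S. if D = C then r e else 0)"
  proof (rule sum.cong[OF refl])
    fix D assume "D \<in> cut_classes S"
    then have "k \<in> D \<longleftrightarrow> D = C" using cut_classesD(3) C(1) k by metis
    then show "r (indicator D) * indicator D k = (if D = C then r e else 0)"
      by (simp add: indicator_def C(2))
  qed
  finally show "r e = 0" using C finite_cut_classes by simp
qed

text \<open>Members of the class keep all inversions of \<open>l\<close>, and inversion sets tell
  extensions apart. This is the unitriangularity of the descent vectors.\<close>

lemma descent_vector_inversions:
  assumes "l \<in> linexts" "descent_vector l k \<noteq> 0"
  shows "k = l \<or> inversions l \<subset> inversions k"
proof -
  have k: "k \<in> cut_class (descents l) l"
    using assms(2) by (auto simp: descent_vector_def indicator_def split: if_splits)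
  then have "inversions l \<subseteq> inversions k" by (rule inversions_mono[OF assms(1)])
  moreover have "k \<in> linexts" using k by (simp add: cut_class_def)
  ultimately show ?thesis using inversions_inj[OF assms(1)] by blast
qed

lemma descent_vector_self: "l \<in> linexts \<Longrightarrow> descent_vector l l = 1"
  by (simp add: descent_vector_def cut_class_self)

lemma inj_on_descent_vector: "inj_on descent_vector linexts"
proof (rule inj_onI)
  fix k l assume kl: "k \<in> linexts" "l \<in> linexts" "descent_vector k = descent_vector l"
  then have "descent_vector k l \<noteq> 0" "descent_vector l k \<noteq> 0"
    using descent_vector_self by (metis zero_neq_one)+
  then show "k = l" using descent_vector_inversions kl by blast
qed

text \<open>At \<open>k\<close> only \<open>descent_vector k\<close> and vectors of extensions with
  fewer inversions can be nonzero; induction on the number of inversions kills the latter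
  coefficients first.\<close>

lemma independent_descent_vectors: "fv.independent (descent_vector ` linexts)"
proof (rule fv.independent_if_scalars_zero)
  fix r e
  assume z: "(\<Sum>e\<in>descent_vector ` linexts. fun_scale (r e) e) = 0" and "e \<in> descent_vector ` linexts"
  then obtain k where k: "k \<in> linexts" "e = descent_vector k" by blast
  have eq: "0 = (\<Sum>l\<in>linexts. r (descent_vector l) * descent_vector l k)" for k
  proof -
    have "0 = (\<Sum>e\<in>descent_vector ` linexts. fun_scale (r e) e) k" using z by simp
    then show ?thesis by (simp add: sum.reindex[OF inj_on_descent_vector] sum_fun_apply)
  qed
  have "r (descent_vector k) = 0"
    using k(1)
  proof (induction "card (inversions k)" arbitrary: k rule: less_induct)
    case less
    have "r (descent_vector l) * descent_vector l k = (if l = k then r (descent_vector k) else 0)"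
      if l: "l \<in> linexts" for l
    proof (cases "descent_vector l k = 0")
      case True
      then show ?thesis using descent_vector_self[OF l] by auto
    next
      case False
      consider "k = l" | "inversions l \<subset> inversions k"
        using descent_vector_inversions[OF l False] by blast
      then show ?thesis
      proof cases
        case 1
        then show ?thesis using descent_vector_self[OF l] by simp
      next
        case 2
        then have "card (inversions l) < card (inversions k)"
          by (rule psubset_card_mono[OF finite_inversions])
        then have "r (descent_vector l) = 0" using less.hyps l by blast
        then show ?thesis using 2 by auto
      qed
    qed
    then have "0 = (\<Sum>l\<in>linexts. if l = k then r (descent_vector k) else 0)"
      using eq[of k] by simp
    then show ?case using less.prems finite_linexts by simp
  qed
  then show "r e = 0" using k by simp
qed (simp add: finite_linexts)

text \<open>The descent vectors involved are independent and lie in the span of the class vectors,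
  so equality is a matter of counting.\<close>

lemma span_descent_vectors:
  "fv.span (descent_vector ` {l \<in> linexts. descents l \<subseteq> S}) = fv.span (class_vectors S)"
proof (rule fv.span_eq_if_card_le[OF _ _ finite_class_vectors])
  let ?L = "{l \<in> linexts. descents l \<subseteq> S}"
  show "fv.independent (descent_vector ` ?L)"
    by (rule fv.independent_mono[OF independent_descent_vectors]) auto
  show "descent_vector ` ?L \<subseteq> fv.span (class_vectors S)"
    unfolding descent_vector_def
    using cut_class_in_cut_classes separates_descents by (auto intro: indicator_cut_class_span)
  \<comment> \<open>Every class has a representative with descents in \<open>S\<close>; local
    speciality enters the count here, through \<open>ex_descents_subset\<close>.\<close>
  have "cut_classes S \<subseteq> cut_class S ` ?L"
  proof
    fix C assume "C \<in> cut_classes S"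
    then obtain l where l: "l \<in> linexts" "separates S l" "C = cut_class S l"
      by (auto simp: cut_classes_def)
    obtain k where k: "k \<in> cut_class S l" "descents k \<subseteq> S" by (rule ex_descents_subset[OF l(1,2)])
    then have "C = cut_class S k" "k \<in> ?L"
      using l(3) cut_class_eq[of k S l] by (simp_all add: cut_class_def)
    then show "C \<in> cut_class S ` ?L" by (rule image_eqI)
  qed
  then have "card (cut_classes S) \<le> card ?L" by (rule surj_card_le[rotated]) (simp add: finite_linexts)
  then show "card (class_vectors S) \<le> card (descent_vector ` ?L)"
    unfolding class_vectors_def
    by (simp add: card_image[OF inj_on_subset[OF inj_indicator]]
        card_image[OF inj_on_subset[OF inj_on_descent_vector]])
qed

lemma linear_pullback: "Vector_Spaces.linear fun_scale fun_scale (pullback g)"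
  by unfold_locales (auto simp: pullback_def fun_eq_iff algebra_simps)

lemma pullback_span:
  assumes "g \<in> dposet_auto N le1 le2" "v \<in> fv.span (class_vectors S)"
  shows "pullback g v \<in> fv.span (class_vectors S)"
proof (rule fv.linear_image_span_subset[OF linear_pullback _ assms(2)])
  fix e assume "e \<in> class_vectors S"
  then show "pullback g e \<in> fv.span (class_vectors S)"
    using class_image_cut_classes[OF assms(1)]
    by (auto simp: class_vectors_def pullback_indicator intro!: fv.span_base)
qed

section \<open>The descent basis and its diagonal blocks\<close>

definition descent_basis :: "(('a \<Rightarrow> nat) \<Rightarrow> complex) set" where
  "descent_basis = descent_vector ` linexts"

text \<open>The block weights must be attached to the basis vectors themselves, so the extension is
  recovered by inverting \<open>descent_vector\<close>.\<close>

definition descent_set :: "(('a \<Rightarrow> nat) \<Rightarrow> complex) \<Rightarrow> nat set" where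
  "descent_set v = descents (the_inv_into linexts descent_vector v)"

definition pullback_coeff ::
  "('a \<Rightarrow> 'a) \<Rightarrow> (('a \<Rightarrow> nat) \<Rightarrow> complex) \<Rightarrow> (('a \<Rightarrow> nat) \<Rightarrow> complex) \<Rightarrow> complex" where
  "pullback_coeff g v' v = fv.representation descent_basis (pullback g v) v'"

definition descent_character :: "nat set \<Rightarrow> ('a \<Rightarrow> 'a) \<Rightarrow> complex" where
  "descent_character T g = (\<Sum>v\<in>{v \<in> descent_basis. descent_set v = T}. pullback_coeff g v v)"

lemma descent_set_descent_vector: "l \<in> linexts \<Longrightarrow> descent_set (descent_vector l) = descents l"
  by (simp add: descent_set_def the_inv_into_f_f[OF inj_on_descent_vector])

lemma finite_descent_basis: "finite descent_basis"
  by (simp add: descent_basis_def finite_linexts)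

lemma span_descent_set:
  "fv.span {v \<in> descent_basis. descent_set v \<subseteq> S} = fv.span (class_vectors S)"
proof -
  have "{v \<in> descent_basis. descent_set v \<subseteq> S} = descent_vector ` {l \<in> linexts. descents l \<subseteq> S}"
    by (auto simp: descent_basis_def descent_set_descent_vector)
  then show ?thesis using span_descent_vectors by simp
qed

text \<open>Descent sets ordered by inclusion are the weights. Triangularity holds because a descent
  vector lies in the span belonging to its own descent set, which every automorphism maps into
  itself.\<close>

lemma indexed_representation_descent:
  assumes "subgroup H (Aut N le1 le2)"
  shows "indexed_representation (Aut N le1 le2\<lparr>carrier := H\<rparr>)
    {v \<in> descent_basis. descent_set v = T} pullback_coeff"
proof -
  let ?G = "Aut N le1 le2\<lparr>carrier := H\<rparr>"
  have H: "g \<in> dposet_auto N le1 le2" "g \<in> Bij N" if "g \<in> H" for g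
    using subgroup.subset[OF assms] that by (auto simp: Aut_def dposet_auto_def)
  have "monoid ?G"
    using subgroup.subgroup_is_group[OF assms group_Aut] by (rule group.is_monoid)
  moreover have "fv.independent descent_basis"
    unfolding descent_basis_def by (rule independent_descent_vectors)
  moreover have "pullback g v \<in> fv.span {v' \<in> descent_basis. descent_set v' \<le> descent_set v}"
    if "g \<in> carrier ?G" "v \<in> descent_basis" for g v
    using that H span_descent_set[of "descent_set v"] pullback_span[of g v "descent_set v"]
    by (auto intro: fv.span_base)
  \<comment> \<open>The unit of \<open>BijGroup\<close> is the identity restricted to
    \<open>N\<close>, which fixes extensional functions; off \<open>linexts\<close> both sides are
    0.\<close>
  moreover have "pullback \<one>\<^bsub>?G\<^esub> v = v" if v: "v \<in> descent_basis" for v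
  proof
    fix k
    obtain l where l: "l \<in> linexts" "v = descent_vector l"
      using v by (auto simp: descent_basis_def)
    show "pullback \<one>\<^bsub>?G\<^esub> v k = v k"
    proof (cases "k \<in> linexts")
      case True
      then have "compose N k (\<lambda>x\<in>N. x) = k"
        using linextsD(1) by (intro extensionalityI[of _ N]) (auto simp: compose_eq)
      then show ?thesis using True by (simp add: pullback_def Aut_def BijGroup_def)
    next
      case False
      then show ?thesis by (simp add: pullback_def l(2) descent_vector_def cut_class_def indicator_def)
    qed
  qed
  moreover have "pullback (g \<otimes>\<^bsub>?G\<^esub> h) v = pullback g (pullback h v)"
    if "g \<in> carrier ?G" "h \<in> carrier ?G" for g h v
  proof
    fix k :: "'a \<Rightarrow> nat"
    have "h ` N \<subseteq> N" using that H autoD(2) by auto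
    then have "compose N k (compose N g h) = compose N (compose N k g) h"
      by (auto simp: compose_def restrict_def fun_eq_iff)
    then show "pullback (g \<otimes>\<^bsub>?G\<^esub> h) v k = pullback g (pullback h v) k"
      using that H compose_linexts by (simp add: pullback_def Aut_def BijGroup_def)
  qed
  ultimately show ?thesis
    unfolding pullback_coeff_def
    by (intro fv.block_indexed_representation finite_descent_basis linear_pullback) auto
qed

lemma descent_character_eq_0:
  assumes "\<not> T \<subseteq> {1..<card N}"
  shows "descent_character T g = 0"
proof -
  have "descent_set v \<subseteq> {1..<card N}" if v: "v \<in> descent_basis" for v
  proof -
    obtain l where l: "l \<in> linexts" "v = descent_vector l" using v by (auto simp: descent_basis_def)
    show ?thesis using descents_subset[OF l(1)] descent_set_descent_vector[OF l(1)] l(2) by simp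
  qed
  then have "{v \<in> descent_basis. descent_set v = T} = {}" using assms by blast
  then show ?thesis unfolding descent_character_def by (simp only: sum.empty)
qed

text \<open>The trace of \<open>g\<close> on the span of the class vectors is computed in two bases:
  class vectors are permuted, which counts fixed classes, while descent vectors sort the diagonal by
  descent set.\<close>

lemma card_fixed_cut_classes:
  assumes g: "g \<in> dposet_auto N le1 le2" and "finite S"
  shows "of_nat (card {C \<in> cut_classes S. class_image g C = C}) = (\<Sum>T\<in>Pow S. descent_character T g)"
proof -
  let ?B = "{v \<in> descent_basis. descent_set v \<subseteq> S}"
  have ind: "fv.independent descent_basis"
    unfolding descent_basis_def by (rule independent_descent_vectors)
  then have indB: "fv.independent ?B" by (rule fv.independent_mono) auto
  have finB: "finite ?B" by (simp add: finite_descent_basis)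
  have inv: "pullback g v \<in> fv.span ?B" if "v \<in> ?B" for v
    using pullback_span[OF g, of v S] fv.span_base[OF that] by (simp only: span_descent_set)
  have "(\<Sum>T\<in>Pow S. descent_character T g) = (\<Sum>v\<in>?B. pullback_coeff g v v)"
  proof -
    have "(\<Sum>v\<in>?B. pullback_coeff g v v)
        = (\<Sum>T\<in>Pow S. \<Sum>v\<in>{v \<in> ?B. descent_set v = T}. pullback_coeff g v v)"
      using finB assms(2) by (intro sum.group[symmetric]) auto
    also have "\<dots> = (\<Sum>T\<in>Pow S. descent_character T g)"
      unfolding descent_character_def by (intro sum.cong) auto
    finally show ?thesis ..
  qed
  \<comment> \<open>Coordinates in the full basis agree with those in \<open>?B\<close>, since the
    span of \<open>?B\<close> is invariant.\<close>
  also have "\<dots> = (\<Sum>v\<in>?B. fv.representation ?B (pullback g v) v)"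
    unfolding pullback_coeff_def
    using fv.representation_extend[OF ind inv] by (intro sum.cong) auto
  also have "\<dots> = (\<Sum>e\<in>class_vectors S. fv.representation (class_vectors S) (pullback g e) e)"
    by (rule fv.trace_basis_independent[OF finB finite_class_vectors indB independent_class_vectors
          span_descent_set linear_pullback inv])
  also have "\<dots> = of_nat (card {e \<in> class_vectors S. pullback g e = e})"
    by (rule fv.trace_permuted_basis[OF finite_class_vectors independent_class_vectors])
       (use class_image_cut_classes[OF g] in \<open>auto simp: class_vectors_def pullback_indicator\<close>)
  also have "{e \<in> class_vectors S. pullback g e = e}
      = indicator ` {C \<in> cut_classes S. class_image g C = C}"
    by (auto simp: class_vectors_def pullback_indicator inj_eq[OF inj_indicator])
  also have "card \<dots> = card {C \<in> cut_classes S. class_image g C = C}"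
    by (rule card_image[OF inj_on_subset[OF inj_indicator]]) simp
  finally show ?thesis ..
qed

end

section \<open>Refinement and partial sums\<close>

text \<open>Both 0 and the total are included, so that the set alone determines a
  composition.\<close>

definition partial_sums :: "nat list \<Rightarrow> nat set" where
  "partial_sums \<alpha> = (\<lambda>j. sum_list (take j \<alpha>)) ` {..length \<alpha>}"

lemma partial_sums_Nil [simp]: "partial_sums [] = {0}"
  by (simp add: partial_sums_def)

lemma partial_sums_append:
  "partial_sums (\<alpha> @ \<beta>) = partial_sums \<alpha> \<union> (+) (sum_list \<alpha>) ` partial_sums \<beta>"
proof (intro equalityI subsetI)
  fix s assume "s \<in> partial_sums (\<alpha> @ \<beta>)"
  then obtain j where j: "j \<le> length \<alpha> + length \<beta>" "s = sum_list (take j (\<alpha> @ \<beta>))"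
    by (auto simp: partial_sums_def)
  show "s \<in> partial_sums \<alpha> \<union> (+) (sum_list \<alpha>) ` partial_sums \<beta>"
  proof (cases "j \<le> length \<alpha>")
    case True
    then show ?thesis using j by (auto simp: partial_sums_def)
  next
    case False
    then have "s = sum_list \<alpha> + sum_list (take (j - length \<alpha>) \<beta>)" "j - length \<alpha> \<le> length \<beta>"
      using j by auto
    then show ?thesis by (auto simp: partial_sums_def)
  qed
next
  fix s assume "s \<in> partial_sums \<alpha> \<union> (+) (sum_list \<alpha>) ` partial_sums \<beta>"
  then show "s \<in> partial_sums (\<alpha> @ \<beta>)"
  proof
    assume "s \<in> partial_sums \<alpha>"
    then obtain j where "j \<le> length \<alpha>" "s = sum_list (take j \<alpha>)" by (auto simp: partial_sums_def)
    then have "j \<le> length (\<alpha> @ \<beta>)" "s = sum_list (take j (\<alpha> @ \<beta>))" by auto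
    then show ?thesis unfolding partial_sums_def by blast
  next
    assume "s \<in> (+) (sum_list \<alpha>) ` partial_sums \<beta>"
    then obtain j where "j \<le> length \<beta>" "s = sum_list \<alpha> + sum_list (take j \<beta>)"
      by (auto simp: partial_sums_def)
    then have "length \<alpha> + j \<le> length (\<alpha> @ \<beta>)" "s = sum_list (take (length \<alpha> + j) (\<alpha> @ \<beta>))" by auto
    then show ?thesis unfolding partial_sums_def by blast
  qed
qed

lemma partial_sums_single: "partial_sums [a] = {0, a}"
  by (simp add: partial_sums_def atMost_Suc insert_commute)

lemma zero_in_partial_sums: "0 \<in> partial_sums \<alpha>"
  unfolding partial_sums_def by (rule image_eqI[of _ _ 0]) auto

lemma partial_sums_Cons: "partial_sums (a # \<alpha>) = insert 0 ((+) a ` partial_sums \<alpha>)"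
proof -
  have "a \<in> (+) a ` partial_sums \<alpha>"
    by (rule image_eqI[of _ _ 0]) (simp_all add: zero_in_partial_sums)
  then show ?thesis
    using partial_sums_append[of "[a]" \<alpha>] by (simp add: partial_sums_single insert_absorb)
qed

lemma sum_list_in_partial_sums: "sum_list \<alpha> \<in> partial_sums \<alpha>"
  unfolding partial_sums_def by (rule image_eqI[of _ _ "length \<alpha>"]) auto

lemma partial_sums_le:
  assumes "s \<in> partial_sums \<alpha>"
  shows "s \<le> sum_list \<alpha>"
proof -
  obtain j where "s = sum_list (take j \<alpha>)" using assms by (auto simp: partial_sums_def)
  then have "s + sum_list (drop j \<alpha>) = sum_list \<alpha>"
    by (simp flip: sum_list_append)
  then show ?thesis by simp
qed

lemma finite_partial_sums: "finite (partial_sums \<alpha>)"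
  by (simp add: partial_sums_def)

section \<open>Refinement as inclusion of partial sums\<close>

lemma refined_by_Cons:
  "refined_by (a # \<alpha>) \<beta> \<longleftrightarrow> (\<exists>\<gamma> \<beta>'. \<beta> = \<gamma> @ \<beta>' \<and> sum_list \<gamma> = a \<and> refined_by \<alpha> \<beta>')"
    (is "?L \<longleftrightarrow> ?R")
proof
  assume ?L
  then obtain \<gamma>s where \<gamma>s: "concat \<gamma>s = \<beta>" "map sum_list \<gamma>s = a # \<alpha>"
    unfolding refined_by_def by (elim exE conjE)
  then obtain \<gamma> \<delta>s where \<delta>s: "\<gamma>s = \<gamma> # \<delta>s" by (cases \<gamma>s) simp_all
  have "refined_by \<alpha> (concat \<delta>s)" unfolding refined_by_def using \<gamma>s \<delta>s by (intro exI[of _ \<delta>s]) simp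
  moreover have "\<beta> = \<gamma> @ concat \<delta>s" "sum_list \<gamma> = a" using \<gamma>s \<delta>s by simp_all
  ultimately show ?R by blast
next
  assume ?R
  then obtain \<gamma> \<beta>' \<gamma>s where "\<beta> = \<gamma> @ \<beta>'" "sum_list \<gamma> = a" "concat \<gamma>s = \<beta>'" "map sum_list \<gamma>s = \<alpha>"
    unfolding refined_by_def by (elim exE conjE)
  then have "concat (\<gamma> # \<gamma>s) = \<beta>" "map sum_list (\<gamma> # \<gamma>s) = a # \<alpha>" by simp_all
  then show ?L unfolding refined_by_def by (intro exI conjI)
qed

lemma refined_by_sum_list: "refined_by \<alpha> \<beta> \<Longrightarrow> sum_list \<beta> = sum_list \<alpha>"
proof (induction \<alpha> arbitrary: \<beta>)
  case Nil
  then show ?case by (auto simp: refined_by_def)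
next
  case (Cons a \<alpha>)
  then show ?case by (fastforce simp: refined_by_Cons)
qed

text \<open>Induction on \<alpha>: its first part is a partial sum of \<beta>, which tells where
  \<beta> has to be split; the rest of \<beta> is compared after shifting by that part.\<close>

lemma refined_by_iff_partial_sums:
  assumes "\<beta> \<in> compositions" "sum_list \<alpha> = sum_list \<beta>"
  shows "refined_by \<alpha> \<beta> \<longleftrightarrow> partial_sums \<alpha> \<subseteq> partial_sums \<beta>"
  using assms
proof (induction \<alpha> arbitrary: \<beta>)
  case Nil
  then have "\<beta> = []" by (cases \<beta>) (auto simp: compositions_def)
  then show ?case by (simp add: refined_by_refl)
next
  case (Cons a \<alpha>)
  show ?case
  proof
    assume "refined_by (a # \<alpha>) \<beta>"
    then obtain \<gamma> \<beta>' where b: "\<beta> = \<gamma> @ \<beta>'" "sum_list \<gamma> = a" "refined_by \<alpha> \<beta>'"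
      by (auto simp: refined_by_Cons)
    then have "partial_sums \<alpha> \<subseteq> partial_sums \<beta>'"
      using Cons by (auto simp: compositions_def)
    then show "partial_sums (a # \<alpha>) \<subseteq> partial_sums \<beta>"
      using b zero_in_partial_sums[of \<beta>] by (auto simp: partial_sums_Cons partial_sums_append)
  next
    assume sub: "partial_sums (a # \<alpha>) \<subseteq> partial_sums \<beta>"
    then have "a + 0 \<in> partial_sums \<beta>" using zero_in_partial_sums[of \<alpha>] by (auto simp: partial_sums_Cons)
    then obtain j where j: "a = sum_list (take j \<beta>)" by (auto simp: partial_sums_def)
    define \<gamma> \<beta>' where "\<gamma> = take j \<beta>" and "\<beta>' = drop j \<beta>"
    have b: "\<beta> = \<gamma> @ \<beta>'" "sum_list \<gamma> = a" using j by (simp_all add: \<gamma>_def \<beta>'_def)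
    have "partial_sums \<alpha> \<subseteq> partial_sums \<beta>'"
    proof
      fix s assume "s \<in> partial_sums \<alpha>"
      then have "a + s \<in> partial_sums \<gamma> \<union> (+) a ` partial_sums \<beta>'"
        using sub b by (auto simp: partial_sums_Cons partial_sums_append)
      then show "s \<in> partial_sums \<beta>'"
      proof
        assume "a + s \<in> partial_sums \<gamma>"
        then have "s = 0" using partial_sums_le[of "a + s" \<gamma>] b by simp
        then show ?thesis by (simp add: zero_in_partial_sums)
      qed auto
    qed
    moreover have "\<beta>' \<in> compositions" "sum_list \<alpha> = sum_list \<beta>'"
      using Cons.prems b by (auto simp: compositions_def)
    ultimately have "refined_by \<alpha> \<beta>'" using Cons.IH by simp
    then show "refined_by (a # \<alpha>) \<beta>" using b by (auto simp: refined_by_Cons)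
  qed
qed

text \<open>The last part is the gap between \<open>n\<close> and the largest smaller element of
  \<open>T\<close>; the remaining parts come by induction.\<close>

lemma ex_composition_partial_sums:
  assumes "T \<subseteq> {..n}" "0 \<in> T" "n \<in> T"
  obtains \<alpha> where "\<alpha> \<in> compositions" "sum_list \<alpha> = n" "partial_sums \<alpha> = T"
proof -
  have "\<exists>\<alpha>\<in>compositions. sum_list \<alpha> = n \<and> partial_sums \<alpha> = T"
    using assms
  proof (induction n arbitrary: T rule: less_induct)
    case (less n)
    show ?case
    proof (cases "n = 0")
      case True
      then have "T = {0}" using less.prems by auto
      then show ?thesis using True by (intro bexI[of _ "[]"]) (auto simp: compositions_def)
    next
      case False
      define t where "t = Max (T - {n})"
      have fin: "finite (T - {n})" using less.prems(1) finite_subset by blast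
      have t: "t \<in> T - {n}" unfolding t_def using False less.prems fin by (intro Max_in) auto
      then have "t < n" using less.prems(1) by force
      have "T - {n} \<subseteq> {..t}" unfolding t_def using Max_ge[OF fin] by blast
      then obtain \<alpha> where \<alpha>: "\<alpha> \<in> compositions" "sum_list \<alpha> = t" "partial_sums \<alpha> = T - {n}"
        using less.IH[OF \<open>t < n\<close>, of "T - {n}"] t False less.prems(2) by blast
      have "partial_sums (\<alpha> @ [n - t]) = T"
        using \<alpha> t \<open>t < n\<close> less.prems(3)
        by (simp add: partial_sums_append partial_sums_single insert_absorb)
      then show ?thesis
        using \<alpha> \<open>t < n\<close> by (intro bexI[of _ "\<alpha> @ [n - t]"]) (auto simp: compositions_def)
    qed
  qed
  then show thesis using that by blast
qed

text \<open>Equal partial sums give refinement in both directions, hence equal lengths, and a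
  refinement of equal length is trivial.\<close>

lemma partial_sums_inj:
  assumes "\<alpha> \<in> compositions" "\<beta> \<in> compositions" "partial_sums \<alpha> = partial_sums \<beta>"
  shows "\<alpha> = \<beta>"
proof -
  have "sum_list \<alpha> = sum_list \<beta>"
    using partial_sums_le sum_list_in_partial_sums assms(3) by (metis le_antisym)
  then have "refined_by \<alpha> \<beta>" "refined_by \<beta> \<alpha>" using assms by (auto simp: refined_by_iff_partial_sums)
  then show ?thesis using refined_by_length assms by (metis le_antisym)
qed

text \<open>Only interior cuts are kept, because descents of a linear extension never sit at 0 or at
  \<open>card N\<close>.\<close>

definition cuts :: "nat list \<Rightarrow> nat set" where
  "cuts \<alpha> = partial_sums \<alpha> - {0, sum_list \<alpha>}"

text \<open>A coarsening of \<beta> is given by the interior cuts that it retains. This converts the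
  sum over coarsenings in the \<open>F\<close>-expansion into a sum over subsets.\<close>

lemma bij_betw_cuts:
  assumes "\<beta> \<in> compositions"
  shows "bij_betw cuts {\<alpha> \<in> compositions. sum_list \<alpha> = sum_list \<beta> \<and> refined_by \<alpha> \<beta>} (Pow (cuts \<beta>))"
  unfolding bij_betw_def
proof
  have ps: "partial_sums \<alpha> = cuts \<alpha> \<union> {0, sum_list \<alpha>}" for \<alpha>
    using zero_in_partial_sums sum_list_in_partial_sums by (auto simp: cuts_def)
  show "inj_on cuts {\<alpha> \<in> compositions. sum_list \<alpha> = sum_list \<beta> \<and> refined_by \<alpha> \<beta>}"
  proof (rule inj_onI; clarify)
    fix \<alpha> \<gamma> assume "\<alpha> \<in> compositions" "\<gamma> \<in> compositions" "sum_list \<alpha> = sum_list \<beta>"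
      "sum_list \<gamma> = sum_list \<beta>" "cuts \<alpha> = cuts \<gamma>"
    then show "\<alpha> = \<gamma>" using ps[of \<alpha>] ps[of \<gamma>] by (intro partial_sums_inj) auto
  qed
  show "cuts ` {\<alpha> \<in> compositions. sum_list \<alpha> = sum_list \<beta> \<and> refined_by \<alpha> \<beta>} = Pow (cuts \<beta>)"
  proof (intro equalityI subsetI)
    fix T assume "T \<in> cuts ` {\<alpha> \<in> compositions. sum_list \<alpha> = sum_list \<beta> \<and> refined_by \<alpha> \<beta>}"
    then obtain \<alpha> where "sum_list \<alpha> = sum_list \<beta>" "partial_sums \<alpha> \<subseteq> partial_sums \<beta>" "T = cuts \<alpha>"
      using refined_by_iff_partial_sums[OF assms] by auto
    then show "T \<in> Pow (cuts \<beta>)" by (auto simp: cuts_def)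
  next
    fix T assume T: "T \<in> Pow (cuts \<beta>)"
    then have "T \<union> {0, sum_list \<beta>} \<subseteq> {..sum_list \<beta>}" using partial_sums_le by (auto simp: cuts_def)
    then obtain \<alpha> where \<alpha>: "\<alpha> \<in> compositions" "sum_list \<alpha> = sum_list \<beta>"
        "partial_sums \<alpha> = T \<union> {0, sum_list \<beta>}"
      by (rule ex_composition_partial_sums) auto
    have "refined_by \<alpha> \<beta>"
      using refined_by_iff_partial_sums[OF assms \<alpha>(2)] \<alpha>(3) T ps[of \<beta>] by auto
    moreover have "T = cuts \<alpha>" using \<alpha> T by (auto simp: cuts_def)
    ultimately show "T \<in> cuts ` {\<alpha> \<in> compositions. sum_list \<alpha> = sum_list \<beta> \<and> refined_by \<alpha> \<beta>}"
      using \<alpha> by auto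
  qed
qed

lemma finite_compositions_sum_list: "finite {\<alpha> \<in> compositions. sum_list \<alpha> = n}"
proof (rule finite_imageD)
  show "finite (partial_sums ` {\<alpha> \<in> compositions. sum_list \<alpha> = n})"
    by (rule finite_subset[of _ "Pow {..n}"]) (auto dest: partial_sums_le)
  show "inj_on partial_sums {\<alpha> \<in> compositions. sum_list \<alpha> = n}"
    by (auto intro: inj_onI partial_sums_inj)
qed

section \<open>Coefficients of fundamental quasisymmetric functions\<close>

lemma monomial_qsym_word_monomial:
  assumes "length i = length \<beta>" "sorted_wrt (<) i" "\<forall>k\<in>set i. 1 \<le> k"
    "\<beta> \<in> compositions" "\<gamma> \<in> compositions"
  shows "monomial_qsym \<gamma> (word_monomial i \<beta>) = (if \<gamma> = \<beta> then 1 else 0)"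
proof -
  have "{s \<in> {k. length k = length \<gamma> \<and> sorted_wrt (<) k \<and> (\<forall>x\<in>set k. 1 \<le> x)}.
      word_monomial s \<gamma> = word_monomial i \<beta>} = (if \<gamma> = \<beta> then {i} else {})"
    using word_monomial_inj[of _ \<gamma> i \<beta>] assms by auto
  then show ?thesis by (simp add: monomial_qsym_def monomial_sum_def)
qed

lemma fundamental_qsym_word_monomial:
  assumes "length i = length \<beta>" "sorted_wrt (<) i" "\<forall>k\<in>set i. 1 \<le> k" "\<beta> \<in> compositions"
  shows "fundamental_qsym \<alpha> (word_monomial i \<beta>) = (if refined_by \<alpha> \<beta> then 1 else 0)"
  unfolding fundamental_qsym_def using assms finite_refinements
  by (subst sum.cong[OF refl, of _ _ "\<lambda>\<gamma>. if \<gamma> = \<beta> then 1 else 0"])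
     (auto simp: monomial_qsym_word_monomial)

text \<open>The monomials left over are those in which the index 0 occurs.\<close>

lemma fundamental_qsym_eq_0:
  assumes "\<And>i \<beta>. length i = length \<beta> \<Longrightarrow> sorted_wrt (<) i \<Longrightarrow> \<forall>k\<in>set i. 1 \<le> k \<Longrightarrow>
    \<beta> \<in> compositions \<Longrightarrow> m \<noteq> word_monomial i \<beta>"
  shows "fundamental_qsym \<alpha> m = 0"
  unfolding fundamental_qsym_def
proof (rule sum.neutral, clarify)
  fix \<beta> assume "\<beta> \<in> compositions"
  then have "{i \<in> {i. length i = length \<beta> \<and> sorted_wrt (<) i \<and> (\<forall>k\<in>set i. 1 \<le> k)}.
      word_monomial i \<beta> = m} = {}"
    using assms by auto
  then show "monomial_qsym \<beta> m = 0"
    unfolding monomial_qsym_def monomial_sum_def by (simp only: card.empty of_nat_0)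
qed

section \<open>Partitions as cut classes\<close>

lemma sum_list_take_mono:
  assumes "j \<le> k"
  shows "sum_list (take j (\<beta> :: nat list)) \<le> sum_list (take k \<beta>)"
proof -
  have "take j \<beta> @ drop j (take k \<beta>) = take k \<beta>"
    using assms by (metis append_take_drop_id min.absorb2 min.commute take_take)
  then show ?thesis by (metis le_add1 sum_list_append)
qed

lemma sum_list_take_Suc: "j < length \<beta> \<Longrightarrow> sum_list (take (Suc j) \<beta>) = sum_list (take j \<beta>) + \<beta> ! j"
  for \<beta> :: "nat list"
  by (simp add: take_Suc_conv_app_nth)

text \<open>Positions \<open>1, ..., sum_list \<beta>\<close> are cut into consecutive intervals of
  lengths \<beta>; this is the index, from 0, of the interval containing \<open>p\<close>.\<close>

definition block :: "nat list \<Rightarrow> nat \<Rightarrow> nat" where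
  "block \<beta> p = (LEAST j. p \<le> sum_list (take (Suc j) \<beta>))"

lemma le_sum_list_take_iff_block:
  assumes "1 \<le> p" "p \<le> sum_list \<beta>" "j \<le> length \<beta>"
  shows "p \<le> sum_list (take j \<beta>) \<longleftrightarrow> block \<beta> p < j"
proof
  assume le: "p \<le> sum_list (take j \<beta>)"
  then obtain j' where "j = Suc j'" using assms(1) by (cases j) auto
  then show "block \<beta> p < j" using le by (auto simp: block_def less_Suc_eq_le intro: Least_le)
next
  assume less: "block \<beta> p < j"
  have "p \<le> sum_list (take (Suc (length \<beta>)) \<beta>)" using assms(2) by simp
  then have "p \<le> sum_list (take (Suc (block \<beta> p)) \<beta>)" unfolding block_def by (rule LeastI)
  also have "\<dots> \<le> sum_list (take j \<beta>)" using less by (intro sum_list_take_mono) simp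
  finally show "p \<le> sum_list (take j \<beta>)" .
qed

lemma block_less_length: "1 \<le> p \<Longrightarrow> p \<le> sum_list \<beta> \<Longrightarrow> block \<beta> p < length \<beta>"
  using le_sum_list_take_iff_block[of p \<beta> "length \<beta>"] by simp

lemma block_mono:
  assumes "1 \<le> p" "p \<le> q" "q \<le> sum_list \<beta>"
  shows "block \<beta> p \<le> block \<beta> q"
proof -
  have "block \<beta> q < length \<beta>" using assms by (intro block_less_length) auto
  then have "q \<le> sum_list (take (Suc (block \<beta> q)) \<beta>)"
    using le_sum_list_take_iff_block[of q \<beta> "Suc (block \<beta> q)"] assms by simp
  then show ?thesis unfolding block_def[of \<beta> p] using assms(2) by (intro Least_le) simp
qed

text \<open>The cut just before the block of \<open>q\<close> is the witness: it lies at or after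
  \<open>p\<close> precisely when \<open>p\<close> is in an earlier block.\<close>

lemma block_less_iff:
  assumes "1 \<le> p" "1 \<le> q" "p \<le> sum_list \<beta>" "q \<le> sum_list \<beta>"
  shows "block \<beta> p < block \<beta> q \<longleftrightarrow> (\<exists>t\<in>partial_sums \<beta>. p \<le> t \<and> t < q)"
proof
  assume less: "block \<beta> p < block \<beta> q"
  let ?t = "sum_list (take (block \<beta> q) \<beta>)"
  have "block \<beta> q \<le> length \<beta>" using block_less_length assms by (simp add: less_imp_le)
  then have "?t \<in> partial_sums \<beta>" "p \<le> ?t" "\<not> q \<le> ?t"
    using le_sum_list_take_iff_block[of _ \<beta> "block \<beta> q"] assms less by (auto simp: partial_sums_def)
  then show "\<exists>t\<in>partial_sums \<beta>. p \<le> t \<and> t < q" by (metis not_le)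
next
  assume "\<exists>t\<in>partial_sums \<beta>. p \<le> t \<and> t < q"
  then obtain j where "j \<le> length \<beta>" "p \<le> sum_list (take j \<beta>)" "\<not> q \<le> sum_list (take j \<beta>)"
    by (auto simp: partial_sums_def)
  then show "block \<beta> p < block \<beta> q" using le_sum_list_take_iff_block assms by auto
qed

lemma lookup_sum_single:
  assumes "finite A"
  shows "Poly_Mapping.lookup (\<Sum>v\<in>A. Poly_Mapping.single (f v) 1) x = card {v \<in> A. f v = x}"
proof -
  have "Poly_Mapping.lookup (\<Sum>v\<in>A. Poly_Mapping.single (f v) 1) x = (\<Sum>v\<in>A. if f v = x then 1 else 0)"
    by (simp add: lookup_sum lookup_single when_def)
  also have "\<dots> = card {v \<in> A. f v = x}" using assms by (simp flip: sum.inter_filter)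
  finally show ?thesis .
qed

section \<open>Fibres of a map whose monomial is given\<close>

context
  fixes A :: "'a set" and f :: "'a \<Rightarrow> nat" and i \<beta> :: "nat list"
  assumes A: "finite A" and i: "length i = length \<beta>" "sorted_wrt (<) i"
    and f: "(\<Sum>v\<in>A. Poly_Mapping.single (f v) 1) = word_monomial i \<beta>"
begin

lemma distinct_i: "distinct i"
  using i(2) strict_sorted_iff by blast

lemma card_fibre: "j < length \<beta> \<Longrightarrow> card {v \<in> A. f v = i ! j} = \<beta> ! j"
  using lookup_sum_single[OF A, of f "i ! j"] lookup_word_monomial[OF i(1) distinct_i] f by simp

lemma label_in_set:
  assumes "v \<in> A"
  shows "f v \<in> set i"
proof (rule ccontr)
  assume "f v \<notin> set i"
  then have "card {u \<in> A. f u = f v} = 0"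
    using lookup_sum_single[OF A, of f "f v"] lookup_word_monomial_notin[OF i(1)] f by simp
  then show False using A assms by auto
qed

lemma card_labels_below:
  "j \<le> length \<beta> \<Longrightarrow> card {v \<in> A. \<exists>k<j. f v = i ! k} = sum_list (take j \<beta>)"
proof (induction j)
  case (Suc j)
  have "{v \<in> A. \<exists>k<Suc j. f v = i ! k} = {v \<in> A. \<exists>k<j. f v = i ! k} \<union> {v \<in> A. f v = i ! j}"
    by (auto simp: less_Suc_eq)
  moreover have "{v \<in> A. \<exists>k<j. f v = i ! k} \<inter> {v \<in> A. f v = i ! j} = {}"
    using distinct_i Suc.prems i(1) by (auto simp: nth_eq_iff_index_eq)
  ultimately show ?case
    using A Suc card_fibre[of j] by (simp add: card_Un_disjoint sum_list_take_Suc)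
qed simp

lemma card_eq_sum_list: "card A = sum_list \<beta>"
proof -
  have "\<exists>k<length \<beta>. f v = i ! k" if "v \<in> A" for v
    using label_in_set[OF that] i(1) by (metis in_set_conv_nth)
  then have "{v \<in> A. \<exists>k<length \<beta>. f v = i ! k} = A" by blast
  then show ?thesis using card_labels_below[of "length \<beta>"] by simp
qed

end

lemma sorted_wrt_nth_le_iff:
  assumes "sorted_wrt (<) (i :: nat list)" "a < length i" "b < length i"
  shows "i ! a \<le> i ! b \<longleftrightarrow> a \<le> b" "i ! a < i ! b \<longleftrightarrow> a < b" "i ! a = i ! b \<longleftrightarrow> a = b"
  using sorted_wrt_nth_less[OF assms(1), of a b] sorted_wrt_nth_less[OF assms(1), of b a] assms(2,3)
  by (cases a b rule: linorder_cases; simp)+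

context special_double_poset
begin

text \<open>Elements in block \<open>j\<close> of the linear extension receive the label
  \<open>i ! j\<close>.\<close>

definition labelling :: "nat list \<Rightarrow> nat list \<Rightarrow> ('a \<Rightarrow> nat) \<Rightarrow> 'a \<Rightarrow> nat" where
  "labelling i \<beta> l = (\<lambda>x\<in>N. i ! block \<beta> (l x))"

lemma labelling_compose:
  assumes "g \<in> dposet_auto N le1 le2"
  shows "labelling i \<beta> (compose N l g) = compose N (labelling i \<beta> l) g"
  using autoD(2)[OF assms] by (auto simp: labelling_def compose_def)

context
  fixes i \<beta> :: "nat list"
  assumes i: "length i = length \<beta>" "sorted_wrt (<) i" "\<forall>k\<in>set i. 1 \<le> k"
    and card_N: "card N = sum_list \<beta>"
begin

lemma linext_block:
  assumes "l \<in> linexts" "x \<in> N"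
  shows "1 \<le> l x" "l x \<le> sum_list \<beta>" "block \<beta> (l x) < length i"
proof -
  show "1 \<le> l x" "l x \<le> sum_list \<beta>" using linextsD(4,5)[OF assms(1)] assms(2) card_N by auto
  then show "block \<beta> (l x) < length i" using block_less_length i(1) by simp
qed

text \<open>A block number is determined by which \<open>j \<le> length \<beta>\<close> exceed it,
  and in terms of partial sums that comparison is the cut condition.\<close>

lemma labelling_eq_iff:
  assumes "l \<in> linexts" "k \<in> linexts"
  shows "labelling i \<beta> k = labelling i \<beta> l \<longleftrightarrow> k \<in> cut_class (partial_sums \<beta>) l"
proof -
  note b = linext_block[OF assms(1)] linext_block[OF assms(2)]
  have "labelling i \<beta> k = labelling i \<beta> l \<longleftrightarrow> (\<forall>x\<in>N. i ! block \<beta> (k x) = i ! block \<beta> (l x))"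
    by (auto simp: labelling_def fun_eq_iff restrict_def)
  also have "\<dots> \<longleftrightarrow> (\<forall>x\<in>N. block \<beta> (k x) = block \<beta> (l x))"
    using sorted_wrt_nth_le_iff(3)[OF i(2)] b by simp
  also have "\<dots> \<longleftrightarrow> (\<forall>x\<in>N. \<forall>j\<le>length \<beta>. block \<beta> (k x) < j \<longleftrightarrow> block \<beta> (l x) < j)"
  proof (intro ball_cong refl iffI)
    fix x assume x: "x \<in> N"
      and *: "\<forall>j\<le>length \<beta>. block \<beta> (k x) < j \<longleftrightarrow> block \<beta> (l x) < j"
    have "block \<beta> (k x) \<le> length \<beta>" "block \<beta> (l x) \<le> length \<beta>" using b[OF x] i(1) by simp_all
    from *[rule_format, OF this(1)] *[rule_format, OF this(2)]
    show "block \<beta> (k x) = block \<beta> (l x)" by simp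
  qed simp
  also have "\<dots> \<longleftrightarrow> (\<forall>x\<in>N. \<forall>j\<le>length \<beta>. k x \<le> sum_list (take j \<beta>) \<longleftrightarrow> l x \<le> sum_list (take j \<beta>))"
    using le_sum_list_take_iff_block b by auto
  also have "\<dots> \<longleftrightarrow> k \<in> cut_class (partial_sums \<beta>) l"
    using assms by (auto simp: cut_class_def partial_sums_def)
  finally show ?thesis .
qed

text \<open>Weak monotonicity is automatic since blocks increase with position; a strict increase of
  the label amounts to a partial sum between the two positions.\<close>

lemma labelling_D_partition_iff:
  assumes "l \<in> linexts"
  shows "labelling i \<beta> l \<in> D_partitions N le1 le2 \<longleftrightarrow> separates (partial_sums \<beta>) l"
proof -
  note b = linext_block[OF assms]
  have lab: "labelling i \<beta> l x = i ! block \<beta> (l x)" if "x \<in> N" for x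
    using that by (simp add: labelling_def)
  have "labelling i \<beta> l \<in> N \<rightarrow>\<^sub>E {1..}"
    using b i(3) by (auto simp: labelling_def)
  moreover have "labelling i \<beta> l x \<le> labelling i \<beta> l y" if "x \<in> N" "y \<in> N" "(x, y) \<in> le1" for x y
    using block_mono[of "l x" "l y" \<beta>] b that linextsD(7)[OF assms that] sorted_wrt_nth_le_iff(1)[OF i(2)]
    by (simp add: lab)
  moreover have "labelling i \<beta> l x < labelling i \<beta> l y \<longleftrightarrow> (\<exists>t\<in>partial_sums \<beta>. l x \<le> t \<and> t < l y)"
    if "x \<in> N" "y \<in> N" for x y
    using that b sorted_wrt_nth_le_iff(2)[OF i(2)] block_less_iff[of "l x" "l y" \<beta>] by (simp add: lab)
  ultimately show ?thesis by (simp add: D_partitions_def separates_def)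
qed

text \<open>The fibre over \<open>i ! j\<close> consists of the positions between two consecutive
  partial sums, of which there are \<open>\<beta> ! j\<close>.\<close>

lemma labelling_monomial:
  assumes l: "l \<in> linexts"
  shows "(\<Sum>v\<in>N. Poly_Mapping.single (labelling i \<beta> l v) 1) = word_monomial i \<beta>"
proof (rule poly_mapping_eqI)
  fix x
  note b = linext_block[OF l]
  have dist: "distinct i" using i(2) strict_sorted_iff by blast
  have lab: "labelling i \<beta> l v = i ! block \<beta> (l v)" if "v \<in> N" for v
    using that by (simp add: labelling_def)
  have "card {v \<in> N. labelling i \<beta> l v = x} = Poly_Mapping.lookup (word_monomial i \<beta>) x"
  proof (cases "x \<in> set i")
    case True
    then obtain j where j: "j < length \<beta>" "x = i ! j" using i(1) by (auto simp: in_set_conv_nth)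
    have below: "card {v \<in> N. l v \<le> sum_list (take j' \<beta>)} = sum_list (take j' \<beta>)" for j'
    proof -
      have "sum_list (take j' \<beta>) \<le> card N"
        using sum_list_take_mono[of j' "max j' (length \<beta>)" \<beta>] card_N by simp
      then show ?thesis using linextsD(2)[OF l] card_le_of_bij_betw by blast
    qed
    have "block \<beta> (l v) = j \<longleftrightarrow> l v \<le> sum_list (take (Suc j) \<beta>) \<and> \<not> l v \<le> sum_list (take j \<beta>)"
      if "v \<in> N" for v
      using le_sum_list_take_iff_block[of "l v" \<beta> j] le_sum_list_take_iff_block[of "l v" \<beta> "Suc j"]
        b[OF that] j(1) by auto
    then have "{v \<in> N. labelling i \<beta> l v = x}
        = {v \<in> N. l v \<le> sum_list (take (Suc j) \<beta>)} - {v \<in> N. l v \<le> sum_list (take j \<beta>)}"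
      using sorted_wrt_nth_le_iff(3)[OF i(2)] b j i(1) lab by auto
    also have "card \<dots> = sum_list (take (Suc j) \<beta>) - sum_list (take j \<beta>)"
      using sum_list_take_mono[of j "Suc j" \<beta>] finite_N by (subst card_Diff_subset) (auto simp only: below, auto)
    also have "\<dots> = \<beta> ! j" using j by (simp add: sum_list_take_Suc)
    finally show ?thesis using lookup_word_monomial[OF i(1) dist] j by simp
  next
    case False
    then have empty: "{v \<in> N. labelling i \<beta> l v = x} = {}" using lab b by auto
    show ?thesis unfolding empty using lookup_word_monomial_notin[OF i(1) False] by simp
  qed
  then show "Poly_Mapping.lookup (\<Sum>v\<in>N. Poly_Mapping.single (labelling i \<beta> l v) 1) x
      = Poly_Mapping.lookup (word_monomial i \<beta>) x"
    unfolding lookup_sum_single[OF finite_N] .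
qed

text \<open>\<open>N\<close> is sorted by \<open>f\<close>, ties being broken by a linear extension
  \<open>h\<close> of \<open>le1\<close>; the rank of an element in this order is its
  position.\<close>

lemma ex_labelling:
  assumes f: "f \<in> D_partitions N le1 le2"
    and m: "(\<Sum>v\<in>N. Poly_Mapping.single (f v) 1) = word_monomial i \<beta>"
  obtains l where "l \<in> linexts" "labelling i \<beta> l = f"
proof -
  obtain h :: "'a \<Rightarrow> nat" where h: "inj_on h N" "\<And>x y. (x, y) \<in> le1 \<Longrightarrow> h x \<le> h y"
    using partial_order_on_rank[OF finite_N po1] by blast
  \<comment> \<open>Despite its name the relation is reflexive, so that the count \<open>l x\<close>
    includes \<open>x\<close> and starts at 1.\<close>
  define less where "less x y \<longleftrightarrow> f x < f y \<or> f x = f y \<and> h x \<le> h y" for x y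
  define l where "l = (\<lambda>x\<in>N. card {y \<in> N. less y x})"
  have l_le: "l x \<le> l y \<longleftrightarrow> less x y" if xy: "x \<in> N" "y \<in> N" for x y
  proof -
    have mono: "{z \<in> N. less z x} \<subseteq> {z \<in> N. less z y}" if "less x y" for x y
      using that by (auto simp: less_def)
    show ?thesis
    proof
      assume "less x y"
      then show "l x \<le> l y" using mono xy finite_N by (simp add: l_def card_mono)
    next
      assume le: "l x \<le> l y"
      show "less x y"
      proof (rule ccontr)
        assume nl: "\<not> less x y"
        then have "less y x" by (auto simp: less_def)
        moreover have "x \<in> {z \<in> N. less z x}" "x \<notin> {z \<in> N. less z y}"
          using xy nl by (auto simp: less_def)
        ultimately have "{z \<in> N. less z y} \<subset> {z \<in> N. less z x}" using mono by blast
        then have "l y < l x" using xy finite_N by (simp add: l_def psubset_card_mono)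
        then show False using le by simp
      qed
    qed
  qed
  have "inj_on l N"
  proof (rule inj_onI)
    fix x y assume xy: "x \<in> N" "y \<in> N" "l x = l y"
    then have "less x y" "less y x" using l_le by (metis order_refl)+
    then have "h x = h y" by (auto simp: less_def)
    then show "x = y" using h(1) xy by (auto simp: inj_on_def)
  qed
  moreover have "l ` N \<subseteq> {1..card N}"
  proof
    fix p assume "p \<in> l ` N"
    then obtain x where x: "x \<in> N" "p = l x" by blast
    then have "x \<in> {y \<in> N. less y x}" by (simp add: less_def)
    then have "0 < l x" using x finite_N by (auto simp: l_def card_gt_0_iff)
    moreover have "l x \<le> card N" using x finite_N by (auto simp: l_def intro: card_mono)
    ultimately show "p \<in> {1..card N}" using x by simp
  qed
  ultimately have "bij_betw l N {1..card N}"
    by (simp add: bij_betw_def card_subset_eq card_image)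
  moreover have "l \<in> extensional N" by (simp add: l_def)
  moreover have "l x \<le> l y" if "x \<in> N" "y \<in> N" "(x, y) \<in> le1" for x y
    using that f h(2)[OF that(3)] l_le[OF that(1,2)] by (auto simp: D_partitions_def less_def le_less)
  ultimately have l: "l \<in> linexts" by (simp add: linexts_def)
  have "labelling i \<beta> l x = f x" if x: "x \<in> N" for x
  proof -
    obtain j where j: "j < length \<beta>" "f x = i ! j"
      using label_in_set[OF finite_N i(1,2) m x] i(1) by (auto simp: in_set_conv_nth)
    note below = card_labels_below[OF finite_N i(1,2) m]
    have "{y \<in> N. less y x} \<subseteq> {y \<in> N. \<exists>k<Suc j. f y = i ! k}"
    proof clarify
      fix y assume y: "y \<in> N" "less y x"
      obtain k where k: "k < length \<beta>" "f y = i ! k"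
        using label_in_set[OF finite_N i(1,2) m y(1)] i(1) by (auto simp: in_set_conv_nth)
      then have "k \<le> j"
        using y j sorted_wrt_nth_le_iff(1)[OF i(2), of k j] i(1) by (auto simp: less_def)
      then show "\<exists>k<Suc j. f y = i ! k" using k by (intro exI[of _ k]) simp
    qed
    then have "l x \<le> sum_list (take (Suc j) \<beta>)"
      using below[of "Suc j"] j x finite_N card_mono[of "{y \<in> N. \<exists>k<Suc j. f y = i ! k}" "{y \<in> N. less y x}"]
      by (simp add: l_def)
    \<comment> \<open>The inclusion is strict because \<open>x\<close> itself is counted; thus
      \<open>l x\<close> lies beyond the first \<open>j\<close> blocks, while the previous bound
      keeps it within the first \<open>Suc j\<close>.\<close>
    moreover have "{y \<in> N. \<exists>k<j. f y = i ! k} \<subset> {y \<in> N. less y x}"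
    proof -
      have less_fx: "i ! k < f x" if "k < j" for k using that j i by (simp add: sorted_wrt_nth_less)
      then have "{y \<in> N. \<exists>k<j. f y = i ! k} \<subseteq> {y \<in> N. less y x}" by (auto simp: less_def)
      moreover have "f x \<noteq> i ! k" if "k < j" for k using less_fx[OF that] by simp
      then have "x \<notin> {y \<in> N. \<exists>k<j. f y = i ! k}" by blast
      moreover have "x \<in> {y \<in> N. less y x}" using x by (simp add: less_def)
      ultimately show ?thesis by blast
    qed
    then have "sum_list (take j \<beta>) < l x"
      using below[of j] j x finite_N psubset_card_mono[of "{y \<in> N. less y x}" "{y \<in> N. \<exists>k<j. f y = i ! k}"]
      by (simp add: l_def)
    ultimately have "block \<beta> (l x) = j"
      using le_sum_list_take_iff_block[of "l x" \<beta> j] le_sum_list_take_iff_block[of "l x" \<beta> "Suc j"]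
        linext_block[OF l x] j(1) by auto
    then show ?thesis using x j by (simp add: labelling_def)
  qed
  then have "labelling i \<beta> l = f"
    using f by (intro extensionalityI[of _ N]) (auto simp: labelling_def D_partitions_def PiE_def)
  then show thesis using l that by blast
qed

text \<open>The linear extensions inducing \<open>f\<close> form one cut class
  \<open>\<Phi> f\<close>, and composing \<open>f\<close> with \<open>g\<close> matches taking
  \<open>class_image g\<close> closely enough that fixed points correspond.\<close>

lemma card_fixed_D_partitions:
  assumes g: "g \<in> dposet_auto N le1 le2"
  shows "card {f \<in> {f \<in> D_partitions N le1 le2. compose N f g = f}.
      (\<Sum>v\<in>N. Poly_Mapping.single (f v) 1) = word_monomial i \<beta>}
    = card {C \<in> cut_classes (partial_sums \<beta>). class_image g C = C}" (is "card ?P = card ?Q")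
proof -
  define \<Phi> where "\<Phi> f = {l \<in> linexts. labelling i \<beta> l = f}" for f
  let ?S = "partial_sums \<beta>"
  have \<Phi>: "\<Phi> (labelling i \<beta> l) = cut_class ?S l" if "l \<in> linexts" for l
    using labelling_eq_iff[OF that] by (auto simp: \<Phi>_def cut_class_def)
  have image: "class_image g (\<Phi> f) = {l \<in> linexts. compose N (labelling i \<beta> l) g = f}" for f
    using labelling_compose[OF g] compose_linexts[OF g] by (auto simp: class_image_def \<Phi>_def)
  have ext: "labelling i \<beta> l \<in> extensional N" for l by (simp add: labelling_def)
  \<comment> \<open>Right cancellation, by surjectivity of \<open>g\<close> on
    \<open>N\<close>.\<close>
  have cancel: "f = f'" if "compose N f g = compose N f' g" "f \<in> extensional N" "f' \<in> extensional N" for f f'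
  proof (rule extensionalityI[OF that(2,3)])
    fix y assume "y \<in> N"
    then obtain x where "x \<in> N" "g x = y" using auto_obtain[OF g] by blast
    then show "f y = f' y" using that(1) by (metis compose_eq)
  qed
  have "bij_betw \<Phi> ?P ?Q"
    unfolding bij_betw_def
  proof
    show "inj_on \<Phi> ?P"
    proof (rule inj_onI)
      fix f f' assume f: "f \<in> ?P" and eq: "\<Phi> f = \<Phi> f'"
      from f obtain l where "l \<in> linexts" "labelling i \<beta> l = f" using ex_labelling by blast
      then have "l \<in> \<Phi> f" by (simp add: \<Phi>_def)
      then have "l \<in> \<Phi> f'" using eq by simp
      then show "f = f'" using \<open>labelling i \<beta> l = f\<close> by (simp add: \<Phi>_def)
    qed
    show "\<Phi> ` ?P = ?Q"
    proof (intro equalityI subsetI)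
      fix C assume "C \<in> \<Phi> ` ?P"
      then obtain f where f: "f \<in> D_partitions N le1 le2" "compose N f g = f" "C = \<Phi> f"
          "(\<Sum>v\<in>N. Poly_Mapping.single (f v) 1) = word_monomial i \<beta>"
        by auto
      obtain l where l: "l \<in> linexts" "labelling i \<beta> l = f" using ex_labelling[OF f(1,4)] .
      then have "C \<in> cut_classes ?S"
        using labelling_D_partition_iff[OF l(1)] \<Phi>[OF l(1)] f cut_class_in_cut_classes by metis
      moreover have "f \<in> extensional N" using f(1) by (auto simp: D_partitions_def PiE_def)
      then have "compose N (labelling i \<beta> k) g = f \<longleftrightarrow> labelling i \<beta> k = f" for k
        using cancel[OF _ ext] f(2) by metis
      then have "class_image g C = C" unfolding f(3) image by (simp add: \<Phi>_def)
      ultimately show "C \<in> ?Q" by simp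
    next
      fix C assume C: "C \<in> ?Q"
      then obtain l where l: "l \<in> linexts" "separates ?S l" "C = cut_class ?S l"
        by (auto simp: cut_classes_def)
      let ?f = "labelling i \<beta> l"
      have "C = \<Phi> ?f" using \<Phi>[OF l(1)] l(3) by simp
      \<comment> \<open>The class contains \<open>l\<close> and equals its own image, so membership
        of \<open>l\<close> in the image says that \<open>?f\<close> is fixed by
        \<open>g\<close>.\<close>
      moreover have "l \<in> class_image g (\<Phi> ?f)"
        using C \<open>C = \<Phi> ?f\<close> l(1) by (simp add: \<Phi>_def)
      then have "compose N ?f g = ?f" unfolding image by simp
      ultimately show "C \<in> \<Phi> ` ?P"
        using labelling_D_partition_iff[OF l(1)] l(2) labelling_monomial[OF l(1)] by blast
    qed
  qed
  then show ?thesis by (rule bij_betw_same_card)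
qed

end

end

section \<open>The expansion\<close>

text \<open>The sorted list of values and the list of fibre sizes do it; the values are positive, so
  the index 0 never occurs.\<close>

lemma D_partition_word_monomial:
  assumes "finite N" "f \<in> D_partitions N le1 le2"
  obtains i \<beta> where "length i = length \<beta>" "sorted_wrt (<) i" "\<forall>k\<in>set i. 1 \<le> k" "\<beta> \<in> compositions"
    "(\<Sum>v\<in>N. Poly_Mapping.single (f v) 1) = word_monomial i \<beta>"
proof -
  define i where "i = sorted_list_of_set (f ` N)"
  define \<beta> where "\<beta> = map (\<lambda>k. card {v \<in> N. f v = k}) i"
  have set: "set i = f ` N" and dist: "distinct i" using assms(1) by (simp_all add: i_def)
  have len: "length i = length \<beta>" by (simp add: \<beta>_def)
  have "0 < card {v \<in> N. f v = k}" if "k \<in> f ` N" for k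
    using that assms(1) by (auto simp: card_gt_0_iff)
  then have "\<beta> \<in> compositions" by (simp add: compositions_def \<beta>_def set)
  moreover have "sorted_wrt (<) i" by (simp add: i_def)
  moreover have "\<forall>k\<in>set i. 1 \<le> k" using assms(2) by (auto simp: set D_partitions_def)
  moreover have "(\<Sum>v\<in>N. Poly_Mapping.single (f v) 1) = word_monomial i \<beta>"
  proof (rule poly_mapping_eqI)
    fix x
    have "card {v \<in> N. f v = x} = Poly_Mapping.lookup (word_monomial i \<beta>) x"
    proof (cases "x \<in> set i")
      case True
      then obtain j where j: "j < length i" "x = i ! j" by (auto simp: in_set_conv_nth)
      then have "\<beta> ! j = card {v \<in> N. f v = x}" by (simp add: \<beta>_def)
      then show ?thesis using lookup_word_monomial[OF len dist, of j] len j by simp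
    next
      case False
      then have empty: "{v \<in> N. f v = x} = {}" using set by auto
      show ?thesis unfolding empty using lookup_word_monomial_notin[OF len False] by simp
    qed
    then show "Poly_Mapping.lookup (\<Sum>v\<in>N. Poly_Mapping.single (f v) 1) x
        = Poly_Mapping.lookup (word_monomial i \<beta>) x"
      unfolding lookup_sum_single[OF assms(1)] .
  qed
  ultimately show thesis using that len by blast
qed

context special_double_poset
begin

lemma Omega_eq_0:
  assumes "\<And>i \<beta>. length i = length \<beta> \<Longrightarrow> sorted_wrt (<) i \<Longrightarrow> \<forall>k\<in>set i. 1 \<le> k \<Longrightarrow>
    \<beta> \<in> compositions \<Longrightarrow> m \<noteq> word_monomial i \<beta>"
  shows "Omega N le1 le2 g m = 0"
proof -
  have "(\<Sum>v\<in>N. Poly_Mapping.single (f v) 1) \<noteq> m" if "f \<in> D_partitions N le1 le2" for f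
    using D_partition_word_monomial[OF finite_N that] assms by metis
  then have "{f \<in> {f \<in> D_partitions N le1 le2. compose N f g = f}.
      (\<Sum>v\<in>N. Poly_Mapping.single (f v) 1) = m} = {}"
    by blast
  then show ?thesis unfolding Omega_def monomial_sum_def by (simp only: card.empty of_nat_0)
qed

lemma Omega_word_monomial:
  assumes i: "length i = length \<beta>" "sorted_wrt (<) i" "\<forall>k\<in>set i. 1 \<le> k"
    and g: "g \<in> dposet_auto N le1 le2"
  shows "Omega N le1 le2 g (word_monomial i \<beta>)
    = (if sum_list \<beta> = card N then \<Sum>T\<in>Pow (cuts \<beta>). descent_character T g else 0)"
proof (cases "sum_list \<beta> = card N")
  case True
  have "Omega N le1 le2 g (word_monomial i \<beta>)
      = of_nat (card {C \<in> cut_classes (partial_sums \<beta>). class_image g C = C})"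
    unfolding Omega_def monomial_sum_def
    using card_fixed_D_partitions[OF i True[symmetric] g] by simp
  also have "\<dots> = (\<Sum>T\<in>Pow (partial_sums \<beta>). descent_character T g)"
    by (rule card_fixed_cut_classes[OF g finite_partial_sums])
  \<comment> \<open>Sets containing 0 or \<open>card N\<close> are not descent sets, so their
    characters vanish.\<close>
  also have "\<dots> = (\<Sum>T\<in>Pow (cuts \<beta>). descent_character T g)"
  proof (rule sum.mono_neutral_right)
    show "\<forall>T\<in>Pow (partial_sums \<beta>) - Pow (cuts \<beta>). descent_character T g = 0"
    proof
      fix T assume "T \<in> Pow (partial_sums \<beta>) - Pow (cuts \<beta>)"
      then have "\<not> T \<subseteq> {1..<card N}" unfolding cuts_def True by force
      then show "descent_character T g = 0" by (rule descent_character_eq_0)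
    qed
  qed (auto simp: finite_partial_sums cuts_def)
  finally show ?thesis using True by simp
next
  case False
  have "(\<Sum>v\<in>N. Poly_Mapping.single (f v) 1) \<noteq> word_monomial i \<beta>" for f
    using card_eq_sum_list[OF finite_N i(1,2)] False by metis
  then have "{f \<in> {f \<in> D_partitions N le1 le2. compose N f g = f}.
      (\<Sum>v\<in>N. Poly_Mapping.single (f v) 1) = word_monomial i \<beta>} = {}"
    by blast
  then have "Omega N le1 le2 g (word_monomial i \<beta>) = 0"
    unfolding Omega_def monomial_sum_def by (simp only: card.empty of_nat_0)
  then show ?thesis using False by simp
qed

text \<open>Coefficients are compared monomial by monomial. At a word monomial with exponents
  \<beta>, exactly the \<alpha> refined by \<beta> contribute, and \<open>bij_betw_cuts\<close>
  matches them with the subsets of \<open>cuts \<beta>\<close>.\<close>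

lemma Omega_expansion:
  assumes g: "g \<in> dposet_auto N le1 le2"
  shows "Omega N le1 le2 g m
    = (\<Sum>\<alpha> | \<alpha> \<in> compositions \<and> sum_list \<alpha> = card N. descent_character (cuts \<alpha>) g * fundamental_qsym \<alpha> m)"
proof (cases "\<exists>i \<beta>. length i = length \<beta> \<and> sorted_wrt (<) i \<and> (\<forall>k\<in>set i. 1 \<le> k) \<and>
    \<beta> \<in> compositions \<and> m = word_monomial i \<beta>")
  case True
  then obtain i \<beta> where i: "length i = length \<beta>" "sorted_wrt (<) i" "\<forall>k\<in>set i. 1 \<le> k"
      and \<beta>: "\<beta> \<in> compositions" "m = word_monomial i \<beta>"
    by blast
  let ?K = "{\<alpha>. \<alpha> \<in> compositions \<and> sum_list \<alpha> = card N}"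
  let ?R = "{\<alpha> \<in> compositions. sum_list \<alpha> = sum_list \<beta> \<and> refined_by \<alpha> \<beta>}"
  have "(\<Sum>\<alpha>\<in>?K. descent_character (cuts \<alpha>) g * fundamental_qsym \<alpha> m)
      = (\<Sum>\<alpha>\<in>?K. if refined_by \<alpha> \<beta> then descent_character (cuts \<alpha>) g else 0)"
    by (intro sum.cong) (simp_all add: \<beta> fundamental_qsym_word_monomial[OF i \<beta>(1)])
  also have "\<dots> = (\<Sum>\<alpha>\<in>{\<alpha> \<in> ?K. refined_by \<alpha> \<beta>}. descent_character (cuts \<alpha>) g)"
    using finite_compositions_sum_list[of "card N"] by (simp flip: sum.inter_filter)
  also have "\<dots> = (if sum_list \<beta> = card N then \<Sum>\<alpha>\<in>?R. descent_character (cuts \<alpha>) g else 0)"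
  proof (cases "sum_list \<beta> = card N")
    case True
    then have "{\<alpha> \<in> ?K. refined_by \<alpha> \<beta>} = ?R" by auto
    then show ?thesis using True by simp
  next
    case False
    then have "{\<alpha> \<in> ?K. refined_by \<alpha> \<beta>} = {}" using refined_by_sum_list by fastforce
    then show ?thesis using False by (simp only: sum.empty if_False)
  qed
  also have "(\<Sum>\<alpha>\<in>?R. descent_character (cuts \<alpha>) g) = (\<Sum>T\<in>Pow (cuts \<beta>). descent_character T g)"
    by (rule sum.reindex_bij_betw[OF bij_betw_cuts[OF \<beta>(1)]])
  finally show ?thesis using Omega_word_monomial[OF i g] \<beta>(2) by simp
next
  case False
  then have m: "m \<noteq> word_monomial i \<beta>"
    if "length i = length \<beta>" "sorted_wrt (<) i" "\<forall>k\<in>set i. 1 \<le> k" "\<beta> \<in> compositions" for i \<beta>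
    using that by blast
  have "Omega N le1 le2 g m = 0" by (rule Omega_eq_0) (rule m)
  moreover have "fundamental_qsym \<alpha> m = 0" for \<alpha> by (rule fundamental_qsym_eq_0) (rule m)
  ultimately show ?thesis by simp
qed

end

theorem theorem7p1:
  fixes N :: "'a set" and le1 le2 :: "'a rel" and H :: "('a \<Rightarrow> 'a) set"
  assumes "finite N"
    and "double_poset N le1 le2"
    and "locally_special N le1 le2"
    and "subgroup H (Aut N le1 le2)"
  shows "F_effective (Aut N le1 le2 \<lparr>carrier := H\<rparr>) (Omega N le1 le2)"
proof -
  have po: "partial_order_on N le1" "partial_order_on N le2"
    using assms(2) by (simp_all add: double_poset_def)
  obtain \<omega> :: "'a \<Rightarrow> nat" where \<omega>: "inj_on \<omega> N" "\<And>x y. (x, y) \<in> le2 \<Longrightarrow> \<omega> x \<le> \<omega> y"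
    using partial_order_on_rank[OF assms(1) po(2)] by blast
  interpret special_double_poset N le1 le2 \<omega>
    using assms po \<omega> by unfold_locales
  let ?G = "Aut N le1 le2 \<lparr>carrier := H\<rparr>"
  have G: "group ?G" by (rule subgroup.subgroup_is_group[OF assms(4) group_Aut])
  have H: "H \<subseteq> dposet_auto N le1 le2" using subgroup.subset[OF assms(4)] by (simp add: Aut_def)
  note rep = indexed_representation_descent[OF assms(4)]
  \<comment> \<open>Since \<open>cuts\<close> forgets the total, compositions of other sizes are
    given the coefficient 0 explicitly.\<close>
  define \<psi> where "\<psi> \<alpha> g = (if sum_list \<alpha> = card N then descent_character (cuts \<alpha>) g else 0)" for \<alpha> g
  have eff: "effective_character ?G (\<psi> \<alpha>)" for \<alpha>
  proof (cases "sum_list \<alpha> = card N")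
    case True
    show ?thesis
      by (rule effective_character_cong[OF effective_character_trace[OF G rep[of "cuts \<alpha>"]]])
        (simp add: \<psi>_def True descent_character_def)
  next
    case False
    show ?thesis by (rule effective_character_cong[OF effective_character_zero]) (simp add: \<psi>_def False)
  qed
  have "class_function ?G (\<psi> \<alpha>)" for \<alpha>
    using class_function_trace[OF G rep[of "cuts \<alpha>"]]
    by (simp add: \<psi>_def descent_character_def class_function_def)
  moreover have K: "{\<alpha> \<in> compositions. \<exists>g\<in>carrier ?G. \<psi> \<alpha> g \<noteq> 0} \<subseteq> {\<alpha> \<in> compositions. sum_list \<alpha> = card N}"
    by (auto simp: \<psi>_def split: if_splits)
  moreover have "Omega N le1 le2 g m
      = (\<Sum>\<alpha> | \<alpha> \<in> compositions \<and> (\<exists>h\<in>carrier ?G. \<psi> \<alpha> h \<noteq> 0). \<psi> \<alpha> g * fundamental_qsym \<alpha> m)"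
    if g: "g \<in> carrier ?G" for g m
  proof -
    have "Omega N le1 le2 g m
        = (\<Sum>\<alpha> | \<alpha> \<in> compositions \<and> sum_list \<alpha> = card N. \<psi> \<alpha> g * fundamental_qsym \<alpha> m)"
      using Omega_expansion[of g m] g H by (auto simp: \<psi>_def intro!: sum.cong)
    \<comment> \<open>Compositions whose coefficient vanishes on all of \<open>H\<close> are dropped
      to reach the index set used in \<open>F_expansion\<close>.\<close>
    also have "\<dots> = (\<Sum>\<alpha> | \<alpha> \<in> compositions \<and> (\<exists>h\<in>carrier ?G. \<psi> \<alpha> h \<noteq> 0). \<psi> \<alpha> g * fundamental_qsym \<alpha> m)"
      using g by (intro sum.mono_neutral_right[OF finite_compositions_sum_list K]) auto
    finally show ?thesis .
  qed
  ultimately have "F_expansion ?G (Omega N le1 le2) \<psi>"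
    unfolding F_expansion_def
    using finite_subset[OF K finite_compositions_sum_list] by blast
  then show ?thesis unfolding F_effective_def using eff by blast
qed

end
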